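(* For all positive integers $k$ and $n$ there is a constant $C>0$ such that the following holds. For every positive integer $q$ there are $\alpha,\beta\in(\mathbb{Z}/q\mathbb{Z})^\times$ with $|\alpha|<C$, $\beta^{n}=\alpha$ and $|n\beta|>C^{-1}q^{1-1/k}$.
   Context: For $a\in\mathbb{Z}/q\mathbb{Z}$, $|a|:=\min\{|a'|:a'\in\mathbb{Z},\ a'\in a+q\mathbb{Z}\}$.
   Formalization: The claim is proved only for q not dividing n (if q divides n, then nβ = 0 and the lower bound fails), and for n = 1 only with k = 1 (if n = 1 and k ≥ 2, then α = β and the two bounds contradict each other for large q). *)

theory Defs
  imports Complex_Main "HOL-Number_Theory.Residues"
begin

(* Z/qZ is residue_ring (int q), whose elements are the integers 0, ..., q - 1. For q = 1 the
   library record has one = 1 outside its carrier {0}, so it must only be used for q > 1. *)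

definition residue_abs :: "nat \<Rightarrow> int \<Rightarrow> nat" where
  "residue_abs q a = (LEAST m. \<exists>a'::int. [a' = a] (mod int q) \<and> m = nat \<bar>a'\<bar>)"

(* The integer multiple n \<beta> in Z/qZ is [n] \<cdot> \<beta> in the library notation (add_pow). If q divides n, it
   is 0 for every \<beta>, and if n = 1, then \<alpha> = \<beta>. So a bound |\<alpha>| < C and a lower bound
   |n \<beta>| > q^(1 - 1/k) / C can hold uniformly in q only for q not dividing n (in particular
   q > 1), and for n = 1 only if k = 1. *)

end

theory Submission
  imports Defs "HOL-Number_Theory.Number_Theory" "HOL-Computational_Algebra.Fundamental_Theorem_Algebra"
begin

text \<open>For \<open>n = 1\<close> or bounded \<open>q\<close> take \<open>\<alpha> = \<beta> = 1\<close>. Otherwise let \<open>G\<close> be the set of primes \<open>p\<close> dividing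
  \<open>q\<close> but not \<open>n\<close> such that there are nontrivial \<open>n\<close>-th roots of unity modulo \<open>p\<close>.

  If \<open>G\<close> has at least \<open>k\<close> elements, some \<open>p \<in> G\<close> contributes a factor \<open>p\<^sup>v \<le> q\<^bsup>1/k\<^esup>\<close> to \<open>q\<close>. For a
  root of unity \<open>\<zeta>\<close> that is nontrivial modulo \<open>p\<^sup>v\<close> and \<open>1\<close> modulo \<open>q / p\<^sup>v\<close>, the residue \<open>n (\<zeta> - 1)\<close> is a
  nonzero multiple of \<open>q / p\<^sup>v\<close>, hence large. Take \<open>\<alpha> = 1\<close> and \<open>\<beta> = \<zeta>\<close>.

  Otherwise, the group of units modulo \<open>n\<close>-th powers is small enough for the pigeonhole principle to
  give \<open>k\<close> disjoint pairs of bounded primes \<open>l, l'\<close> for which \<open>a = l * l' ^ (n - 1)\<close> is an \<open>n\<close>-th power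
  modulo \<open>q\<close>. The \<open>D = n ^ k\<close> products of powers of the real roots of the numbers \<open>a\<close> are linearly
  independent over the integers and span an order, and the corresponding products of roots modulo \<open>q\<close>
  define a ring homomorphism from this order to the residues. A nonzero element of its kernel has
  norm divisible by \<open>q\<close>, and therefore some coefficient at least of the size \<open>q\<^bsup>1/D\<^esup>\<close>. If all
  residues \<open>n * \<beta>\<close> were small, the pigeonhole principle would give a smaller kernel element.\<close>

section \<open>Orders in number fields\<close>

locale order_basis =
  fixes E :: "'i set" and op :: "'i \<Rightarrow> 'i \<Rightarrow> 'i" and c :: "'i \<Rightarrow> 'i \<Rightarrow> int"
    and one :: 'i and b :: "'i \<Rightarrow> real"
  assumes finite_E: "finite E"
    and one_in: "one \<in> E"
    and op_closed: "e \<in> E \<Longrightarrow> f \<in> E \<Longrightarrow> op e f \<in> E"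
    and b_one: "b one = 1"
    and b_mult: "e \<in> E \<Longrightarrow> f \<in> E \<Longrightarrow> b e * b f = of_int (c e f) * b (op e f)"
    and indep: "(\<Sum>e\<in>E. of_int (x e) * b e) = 0 \<Longrightarrow> e \<in> E \<Longrightarrow> x e = 0"
begin

definition val :: "('i \<Rightarrow> int) \<Rightarrow> real" where
  "val x = (\<Sum>e\<in>E. of_int (x e) * b e)"

definition mul :: "('i \<Rightarrow> int) \<Rightarrow> ('i \<Rightarrow> int) \<Rightarrow> 'i \<Rightarrow> int" where
  "mul x y g = (\<Sum>(e, f)\<in>{(e, f) \<in> E \<times> E. op e f = g}. x e * y f * c e f)"

lemma sum_mul:
  fixes w :: "'i \<Rightarrow> 'a::comm_ring_1"
  shows "(\<Sum>g\<in>E. of_int (mul x y g) * w g) =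
    (\<Sum>e\<in>E. \<Sum>f\<in>E. of_int (x e * y f) * (of_int (c e f) * w (op e f)))"
proof -
  have "(\<Sum>g\<in>E. of_int (mul x y g) * w g) =
      (\<Sum>g\<in>E. \<Sum>p\<in>{p \<in> E \<times> E. (case p of (e, f) \<Rightarrow> op e f) = g}.
        case p of (e, f) \<Rightarrow> of_int (x e * y f) * (of_int (c e f) * w (op e f)))"
    unfolding mul_def of_int_sum sum_distrib_right
    by (intro sum.cong refl) (auto simp: mult_ac)
  also have "\<dots> = (\<Sum>p\<in>E \<times> E. case p of (e, f) \<Rightarrow> of_int (x e * y f) * (of_int (c e f) * w (op e f)))"
    by (rule sum.group) (use finite_E op_closed in auto)
  finally show ?thesis
    by (simp add: sum.cartesian_product)
qed

lemma val_mul: "val (mul x y) = val x * val y"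
  unfolding val_def sum_mul sum_product
  by (intro sum.cong refl) (simp add: b_mult[symmetric] mult_ac)

lemma val_eq_iff: "val x = val y \<longleftrightarrow> (\<forall>e\<in>E. x e = y e)"
proof
  assume "val x = val y"
  hence "(\<Sum>e\<in>E. of_int (x e - y e) * b e) = 0"
    by (simp add: val_def left_diff_distrib sum_subtractf)
  from indep[OF this] show "\<forall>e\<in>E. x e = y e" by simp
qed (simp add: val_def)

lemma val_diff: "val (\<lambda>e. x e - y e) = val x - val y"
  by (simp add: val_def left_diff_distrib sum_subtractf)

lemma val_add: "val (\<lambda>e. x e + y e) = val x + val y"
  by (simp add: val_def distrib_right sum.distrib)

lemma val_scale: "val (\<lambda>e. m * x e) = of_int m * val x"
  by (simp add: val_def sum_distrib_left mult_ac)

lemma val_of_int: "val (\<lambda>e. if e = one then m else 0) = of_int m"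
proof -
  have "val (\<lambda>e. if e = one then m else 0) = (\<Sum>e\<in>E. if e = one then of_int m else 0)"
    unfolding val_def by (intro sum.cong) (auto simp: b_one)
  thus ?thesis using finite_E one_in by simp
qed

lemma mul_bound:
  assumes "\<And>e. e \<in> E \<Longrightarrow> \<bar>x e\<bar> \<le> X" and "\<And>e. e \<in> E \<Longrightarrow> \<bar>y e\<bar> \<le> Y"
    and "\<And>e f. e \<in> E \<Longrightarrow> f \<in> E \<Longrightarrow> \<bar>c e f\<bar> \<le> M"
  shows "\<bar>mul x y g\<bar> \<le> int (card E)^2 * (X * Y * M)"
proof -
  let ?S = "{(e, f) \<in> E \<times> E. op e f = g}"
  have nn: "0 \<le> X" "0 \<le> Y" "0 \<le> M"
    using assms(1)[OF one_in] assms(2)[OF one_in] assms(3)[OF one_in one_in] by linarith+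
  have "\<bar>mul x y g\<bar> \<le> (\<Sum>p\<in>?S. \<bar>case p of (e, f) \<Rightarrow> x e * y f * c e f\<bar>)"
    unfolding mul_def by (rule sum_abs)
  also have "\<dots> \<le> (\<Sum>p\<in>?S. X * Y * M)"
    by (intro sum_mono) (auto simp: abs_mult nn intro!: mult_mono assms)
  also have "\<dots> = int (card ?S) * (X * Y * M)" by simp
  also have "\<dots> \<le> int (card (E \<times> E)) * (X * Y * M)"
    by (intro mult_right_mono zle_int[THEN iffD2] card_mono) (use finite_E nn in auto)
  finally show ?thesis by (simp add: card_cartesian_product power2_eq_square)
qed

text \<open>Multiplication by \<open>x\<close> embeds a box of side \<open>q\<close> into the kernel of reduction modulo \<open>q\<close>,
  whose density is \<open>1 / q\<close>. This replaces the fact that \<open>q\<close> divides the norm of \<open>x\<close>.\<close>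

lemma modulus_le_norm_bound:
  fixes q :: nat and \<beta> :: "'i \<Rightarrow> int"
  assumes q: "q > 0"
    and \<beta>_one: "\<beta> one = 1"
    and \<beta>_mult: "\<And>e f. e \<in> E \<Longrightarrow> f \<in> E \<Longrightarrow> [\<beta> e * \<beta> f = c e f * \<beta> (op e f)] (mod int q)"
    and x0: "\<exists>e\<in>E. x e \<noteq> 0"
    and X: "\<And>e. e \<in> E \<Longrightarrow> \<bar>x e\<bar> \<le> int X"
    and M: "\<And>e f. e \<in> E \<Longrightarrow> f \<in> E \<Longrightarrow> \<bar>c e f\<bar> \<le> int M"
    and ker: "[(\<Sum>e\<in>E. x e * \<beta> e) = 0] (mod int q)"
  shows "q \<le> (2 * (card E ^ 2 * (X * M) + 1)) ^ card E"
proof -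
  define W where "W = card E ^ 2 * (X * M) + 1"
  define I where "I = {- int (W * q)..<int (W * q)}"
  define S where "S = {z \<in> E \<rightarrow>\<^sub>E I. [(\<Sum>e\<in>E. z e * \<beta> e) = 0] (mod int q)}"
  define Y where "Y = E \<rightarrow>\<^sub>E {0..<int q}"
  define J where "J = {- int W..<int W}"
  have card_E: "card E = Suc (card (E - {one}))"
    using finite_E one_in by (rule card.remove)
  have card_Y: "card Y = q ^ card E"
    unfolding Y_def using finite_E by (simp add: card_PiE)
  have inj: "inj_on (\<lambda>y. restrict (mul x y) E) Y"
  proof (rule inj_onI)
    fix y y' assume y: "y \<in> Y" "y' \<in> Y" and eq: "restrict (mul x y) E = restrict (mul x y') E"
    have "\<forall>e\<in>E. mul x y e = mul x y' e"
      using eq by (metis restrict_apply')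
    hence "val x * val y = val x * val y'"
      using val_mul val_eq_iff by metis
    moreover have "val x \<noteq> 0"
      using x0 indep unfolding val_def by blast
    ultimately have "\<forall>e\<in>E. y e = y' e" by (simp add: val_eq_iff)
    thus "y = y'" using y unfolding Y_def by (intro PiE_ext) auto
  qed
  have sub: "(\<lambda>y. restrict (mul x y) E) ` Y \<subseteq> S"
  proof safe
    fix y assume y: "y \<in> Y"
    have yb: "\<bar>y e\<bar> \<le> int q" if "e \<in> E" for e
    proof -
      have "y e \<in> {0..<int q}" using y that unfolding Y_def by (rule PiE_mem)
      thus ?thesis by simp
    qed
    have bound: "\<bar>mul x y g\<bar> < int (W * q)" for g
    proof -
      have "\<bar>mul x y g\<bar> \<le> int (card E)^2 * (int X * int q * int M)"
        using X M yb by (intro mul_bound) auto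
      also have "\<dots> < int (W * q)"
        using q by (simp add: W_def algebra_simps)
      finally show ?thesis .
    qed
    have "mul x y g \<in> I" for g
      using bound[of g] unfolding I_def by auto
    hence "restrict (mul x y) E \<in> E \<rightarrow>\<^sub>E I" by simp
    moreover have "[(\<Sum>e\<in>E. restrict (mul x y) E e * \<beta> e) = 0] (mod int q)"
    proof -
      have "(\<Sum>e\<in>E. restrict (mul x y) E e * \<beta> e) =
          (\<Sum>e\<in>E. \<Sum>f\<in>E. (x e * y f) * (c e f * \<beta> (op e f)))"
        using sum_mul[of x y \<beta>] by simp
      also have "[\<dots> = (\<Sum>e\<in>E. \<Sum>f\<in>E. (x e * y f) * (\<beta> e * \<beta> f))] (mod int q)"
        by (intro cong_sum cong_mult cong_refl cong_sym[OF \<beta>_mult])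
      also have "(\<Sum>e\<in>E. \<Sum>f\<in>E. (x e * y f) * (\<beta> e * \<beta> f)) =
          (\<Sum>e\<in>E. x e * \<beta> e) * (\<Sum>f\<in>E. y f * \<beta> f)"
        unfolding sum_product by (simp add: mult_ac)
      also have "[\<dots> = 0 * (\<Sum>f\<in>E. y f * \<beta> f)] (mod int q)"
        by (intro cong_mult ker cong_refl)
      finally show ?thesis by simp
    qed
    ultimately show "restrict (mul x y) E \<in> S" unfolding S_def by simp
  qed
  define h where "h = (\<lambda>z. (restrict z (E - {one}), z one div int q))"
  have "inj_on h S"
  proof (rule inj_onI)
    fix z z' assume z: "z \<in> S" "z' \<in> S" and eq: "h z = h z'"
    have same: "z e = z' e" if "e \<in> E - {one}" for e
      using eq that unfolding h_def by (metis prod.inject restrict_apply')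
    have "(\<Sum>e\<in>E. z e * \<beta> e) - (\<Sum>e\<in>E. z' e * \<beta> e) = z one - z' one"
      using same \<beta>_one by (simp add: sum.remove[OF finite_E one_in])
    moreover have "[(\<Sum>e\<in>E. z e * \<beta> e) - (\<Sum>e\<in>E. z' e * \<beta> e) = 0 - 0] (mod int q)"
      using z unfolding S_def by (intro cong_diff) auto
    ultimately have "z one mod int q = z' one mod int q"
      by (simp add: cong_iff_dvd_diff mod_eq_dvd_iff)
    moreover have "z one div int q = z' one div int q"
      using eq by (simp add: h_def)
    ultimately have "z one = z' one" by (metis mult_div_mod_eq)
    thus "z = z'" using z same unfolding S_def by (intro PiE_ext[of z E "\<lambda>_. I" z']) auto
  qed
  moreover have "h ` S \<subseteq> ((E - {one}) \<rightarrow>\<^sub>E I) \<times> J"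
  proof (rule image_subsetI)
    fix z assume z: "z \<in> S"
    hence "z one \<in> I" using one_in by (auto simp: S_def)
    hence "- (int W * int q) \<le> z one" "z one < int W * int q" by (simp_all add: I_def)
    moreover have "0 \<le> z one mod int q" "z one mod int q < int q" using q by simp_all
    moreover have "z one = z one div int q * int q + z one mod int q" by simp
    ultimately have "z one div int q * int q < int W * int q"
        "(- int W) * int q < (z one div int q + 1) * int q"
      unfolding distrib_right mult_minus_left mult_1_left by linarith+
    hence "z one div int q \<in> J"
      using q unfolding mult_less_cancel_right by (auto simp: J_def)
    thus "h z \<in> ((E - {one}) \<rightarrow>\<^sub>E I) \<times> J"
      using z unfolding h_def S_def by auto
  qed
  ultimately have "card S \<le> card (((E - {one}) \<rightarrow>\<^sub>E I) \<times> J)"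
    by (rule card_inj_on_le) (auto simp: I_def J_def finite_E intro!: finite_PiE)
  also have "\<dots> = (2 * W * q) ^ card (E - {one}) * (2 * W)"
  proof -
    have "card I = 2 * W * q" by (simp add: I_def flip: of_nat_mult of_nat_add)
    moreover have "card J = 2 * W" by (simp add: J_def flip: of_nat_add)
    ultimately show ?thesis using finite_E by (simp add: card_cartesian_product card_PiE)
  qed
  finally have "card S \<le> (2 * W) ^ card E * q ^ card (E - {one})"
    by (simp add: card_E power_mult_distrib mult_ac)
  moreover have "finite (E \<rightarrow>\<^sub>E I)"
    by (intro finite_PiE finite_E) (simp add: I_def)
  hence "finite S" by (rule finite_subset[rotated]) (auto simp: S_def)
  hence "q * q ^ card (E - {one}) \<le> card S"
    unfolding power_Suc[symmetric] card_E[symmetric] card_Y[symmetric]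
    by (rule card_inj_on_le[OF inj sub])
  ultimately have "q * q ^ card (E - {one}) \<le> (2 * W) ^ card E * q ^ card (E - {one})"
    by (rule order.trans[rotated])
  thus ?thesis using q unfolding mult_le_cancel2 by (simp add: W_def)
qed

lemma ex_int_multiple:
  assumes x0: "val x \<noteq> 0"
  shows "\<exists>y N. N \<noteq> 0 \<and> val x * val y = of_int N"
proof -
  define X where "X = Max ((\<lambda>e. nat \<bar>x e\<bar>) ` E)"
  define M where "M = Max ((\<lambda>(e, f). nat \<bar>c e f\<bar>) ` (E \<times> E))"
  have X: "\<bar>x e\<bar> \<le> int X" if "e \<in> E" for e
    using that finite_E unfolding X_def by (subst nat_le_iff[symmetric]) (auto intro!: Max_ge)
  have M: "\<bar>c e f\<bar> \<le> int M" if "e \<in> E" "f \<in> E" for e f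
    using that finite_E unfolding M_def by (subst nat_le_iff[symmetric]) (auto intro!: Max_ge)
  define W where "W = card E ^ 2 * (X * M) + 1"
  define K where "K = (2 * W + 1) ^ card E"
  define Y where "Y = (E \<rightarrow>\<^sub>E {0..int K}) \<times> {0..int K}"
  define I where "I = {- int (W * (K + 1))..int (W * (K + 1))}"
  define h where "h = (\<lambda>(y, m). restrict (\<lambda>e. mul x y e + (if e = one then m else 0)) E)"
  have "h ` Y \<subseteq> E \<rightarrow>\<^sub>E I"
  proof (rule image_subsetI)
    fix p assume "p \<in> Y"
    then obtain y m where p: "p = (y, m)" and ym: "(y, m) \<in> Y" by (cases p) auto
    have yb: "\<bar>y e\<bar> \<le> int K" if "e \<in> E" for e
    proof -
      have "y e \<in> {0..int K}" using ym that unfolding Y_def by blast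
      thus ?thesis by simp
    qed
    have bound: "\<bar>mul x y g + (if g = one then m else 0)\<bar> \<le> int (W * (K + 1))" for g
    proof -
      have "\<bar>mul x y g\<bar> \<le> int (card E)^2 * (int X * int K * int M)"
        using X M yb by (intro mul_bound) auto
      also have "\<dots> = int ((card E ^ 2 * (X * M)) * K)" by simp
      finally have 1: "\<bar>mul x y g\<bar> \<le> int ((card E ^ 2 * (X * M)) * K)" .
      have 2: "\<bar>if g = one then m else 0\<bar> \<le> int K" using ym by (auto simp: Y_def)
      have "\<bar>mul x y g + (if g = one then m else 0)\<bar> \<le> int ((card E ^ 2 * (X * M)) * K) + int K"
        using 1 2 by linarith
      also have "\<dots> = int (W * K)" by (simp add: W_def algebra_simps)
      also have "\<dots> \<le> int (W * (K + 1))" by simp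
      finally show ?thesis .
    qed
    have "mul x y g + (if g = one then m else 0) \<in> I" for g
      using bound[of g] unfolding I_def abs_le_iff by auto
    thus "h p \<in> E \<rightarrow>\<^sub>E I" unfolding h_def p by simp
  qed
  moreover have "card (E \<rightarrow>\<^sub>E I) < card Y"
  proof -
    have "card I = 2 * W * (K + 1) + 1"
      unfolding I_def card_atLeastAtMost_int by linarith
    also have "\<dots> \<le> (2 * W + 1) * (K + 1)" by simp
    finally have "card (E \<rightarrow>\<^sub>E I) \<le> ((2 * W + 1) * (K + 1)) ^ card E"
      using finite_E by (simp add: card_PiE power_mono)
    also have "\<dots> = K * (K + 1) ^ card E" by (simp only: K_def power_mult_distrib)
    also have "\<dots> < (K + 1) * (K + 1) ^ card E" by simp
    also have "\<dots> = card Y" using finite_E by (simp add: Y_def card_PiE card_cartesian_product nat_add_distrib)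
    finally show ?thesis .
  qed
  moreover have "finite (E \<rightarrow>\<^sub>E I)" by (auto simp: I_def finite_E intro!: finite_PiE)
  ultimately have "\<not> inj_on h Y"
    by (metis card_inj_on_le not_le)
  then obtain y m y' m' where Y: "(y, m) \<in> Y" "(y', m') \<in> Y" and ne: "(y, m) \<noteq> (y', m')"
    and eq: "h (y, m) = h (y', m')"
    unfolding inj_on_def by auto
  have "val (\<lambda>e. mul x y e + (if e = one then m else 0)) = val (\<lambda>e. mul x y' e + (if e = one then m' else 0))"
    unfolding val_eq_iff using eq unfolding h_def by (metis (no_types, lifting) case_prod_conv restrict_apply')
  hence *: "val x * val y + of_int m = val x * val y' + of_int m'"
    by (simp add: val_add val_of_int val_mul)
  have "m \<noteq> m'"
  proof
    assume "m = m'"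
    with * x0 have "val y = val y'" by simp
    hence "y = y'" using Y unfolding Y_def val_eq_iff by (intro PiE_ext[of y E "\<lambda>_. {0..int K}" y']) auto
    with \<open>m = m'\<close> ne show False by simp
  qed
  moreover have "val x * val (\<lambda>e. y e - y' e) = of_int (m' - m)"
    using * by (simp add: val_diff algebra_simps)
  ultimately show ?thesis by (intro exI[of _ "\<lambda>e. y e - y' e"] exI[of _ "m' - m"]) auto
qed

end

section \<open>Roots modulo composite numbers\<close>

lemma hensel_nth_power:
  fixes a x :: int
  assumes p: "prime p" and n: "n > 0"
    and v: "v = multiplicity p n"
    and x: "[x ^ n = a] (mod int p ^ (2 * v + 1))" and px: "\<not> int p dvd x"
  shows "\<exists>y. \<not> int p dvd y \<and> [y ^ n = a] (mod int p ^ (2 * v + 1 + j))"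
proof (induction j)
  case 0
  thus ?case using x px by auto
next
  case (Suc j)
  then obtain y where py: "\<not> int p dvd y" and y: "[y ^ n = a] (mod int p ^ (2 * v + 1 + j))"
    by blast
  define m where "m = v + 1 + j"
  from y obtain w where w: "y ^ n - a = int p ^ (m + v) * w"
    by (auto simp: cong_iff_dvd_diff m_def add_ac mult_2)
  obtain n' where n': "n = p ^ v * n'" and pn': "\<not> p dvd n'"
    unfolding v by (rule multiplicity_decompose'[of n p]) (use n p not_prime_unit in auto)
  have ni: "int n = int p ^ v * int n'" using n' by (metis of_nat_mult of_nat_power)
  have "prime (int p)" using p by simp
  hence "coprime (int n' * y ^ (n - 1)) (int p)"
    using p pn' py prime_imp_coprime[of "int p" "int n'"] prime_imp_coprime[of "int p" y]
    by (auto simp: coprime_commute)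
  then obtain h0 where h0: "[int n' * y ^ (n - 1) * h0 = 1] (mod int p)"
    using cong_solve_coprime_int by blast
  define h where "h = - (w * h0)"
  define z where "z = y + int p ^ m * h"
  have "\<exists>t. (y + u) ^ n = y ^ n + of_nat n * y ^ (n - 1) * u + u ^ 2 * t" for u :: int
  proof (cases "n \<ge> 2")
    case True
    then obtain k where k: "n = Suc (Suc k)" by (metis add_2_eq_Suc le_Suc_ex)
    have "(u + y) ^ n = (\<Sum>i\<le>n. of_nat (n choose i) * u ^ i * y ^ (n - i))"
      by (rule binomial_ring)
    also have "\<dots> = y ^ n + of_nat n * u * y ^ (n - 1) +
        (\<Sum>i\<le>k. of_nat (n choose (i + 2)) * u ^ (i + 2) * y ^ (n - (i + 2)))"
      unfolding k sum.atMost_Suc_shift by simp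
    also have "(\<Sum>i\<le>k. of_nat (n choose (i + 2)) * u ^ (i + 2) * y ^ (n - (i + 2))) =
        u ^ 2 * (\<Sum>i\<le>k. of_nat (n choose (i + 2)) * u ^ i * y ^ (n - (i + 2)))"
      unfolding sum_distrib_left by (intro sum.cong) (simp_all add: power_add power2_eq_square mult_ac)
    finally show ?thesis
      by (intro exI[of _ "\<Sum>i\<le>k. of_nat (n choose (i + 2)) * u ^ i * y ^ (n - (i + 2))"])
        (simp only: add.commute[of y u] mult.assoc mult.commute[of u])
  next
    case False
    hence "n = 1" using n by simp
    thus ?thesis by (intro exI[of _ 0]) simp
  qed
  then obtain t where "z ^ n = y ^ n + of_nat n * y ^ (n - 1) * (int p ^ m * h) + (int p ^ m * h) ^ 2 * t"
    unfolding z_def by blast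
  hence "z ^ n - a = int p ^ (m + v) * (w + int n' * y ^ (n - 1) * h) + int p ^ (2 * m) * (h ^ 2 * t)"
    using w ni unfolding mult_2 by (simp add: algebra_simps power_add power2_eq_square)
  moreover have "int p ^ Suc (m + v) dvd int p ^ (m + v) * (w + int n' * y ^ (n - 1) * h)"
  proof -
    have "[w + w * (- (int n' * y ^ (n - 1) * h0)) = w + w * (- 1)] (mod int p)"
      by (intro cong_add cong_mult cong_refl) (use h0 in \<open>simp add: cong_minus_minus_iff\<close>)
    hence "int p dvd w + int n' * y ^ (n - 1) * h"
      by (simp add: h_def cong_0_iff mult_ac)
    thus ?thesis by (simp add: mult_dvd_mono mult.commute)
  qed
  moreover have "int p ^ Suc (m + v) dvd int p ^ (2 * m) * (h ^ 2 * t)"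
    by (intro dvd_mult2 le_imp_power_dvd) (simp add: m_def)
  ultimately have "int p ^ Suc (m + v) dvd z ^ n - a" by simp
  hence "[z ^ n = a] (mod int p ^ (2 * v + 1 + Suc j))"
    by (simp add: cong_iff_dvd_diff m_def add_ac mult_2)
  moreover have "\<not> int p dvd z"
    using py unfolding z_def m_def by (simp add: dvd_add_left_iff)
  ultimately show ?case by blast
qed

lemma nth_power_mod_prime_power:
  fixes a z :: int
  assumes p: "prime p" and "n > 0" and pn: "p dvd n"
    and "[a = z ^ n] (mod int (n ^ 3))" and z: "\<not> int p dvd z"
  shows "\<exists>y. [y ^ n = a] (mod int p ^ e)"
proof -
  define v where "v = multiplicity p n"
  have "v \<ge> 1" unfolding v_def
    by (rule multiplicity_geI) (use assms not_prime_unit in auto)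
  have "p ^ v dvd n" unfolding v_def by (rule multiplicity_dvd)
  hence "p ^ (v * 3) dvd n ^ 3" unfolding power_mult by (rule dvd_power_same)
  moreover have "p ^ (2 * v + 1) dvd p ^ (v * 3)" using \<open>v \<ge> 1\<close> by (intro le_imp_power_dvd) auto
  ultimately have "int (p ^ (2 * v + 1)) dvd int (n ^ 3)"
    unfolding int_dvd_int_iff by (rule dvd_trans[rotated])
  with assms(4) have "[z ^ n = a] (mod int p ^ (2 * v + 1))"
    unfolding of_nat_power[symmetric] by (rule cong_sym[OF cong_dvd_modulus])
  from hensel_nth_power[OF p assms(2) v_def this z, of e] obtain y
    where "[y ^ n = a] (mod int p ^ (2 * v + 1 + e))" by blast
  hence "[y ^ n = a] (mod int p ^ e)"
    by (rule cong_dvd_modulus) (simp add: le_imp_power_dvd)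
  thus ?thesis ..
qed

lemma nth_power_mod_coprime_totient:
  fixes a m n :: nat
  assumes "coprime a m" and "coprime n (totient m)"
  shows "\<exists>y. [y ^ n = a] (mod m)"
proof -
  obtain j where j: "[n * j = Suc 0] (mod totient m)"
    using cong_solve_coprime_nat[OF assms(2)] by blast
  have am: "coprime m a" using assms(1) by (simp add: coprime_commute)
  have "[j * n = Suc 0] (mod ord m a)"
    using j order_divides_totient[OF am] unfolding mult.commute[of n] by (rule cong_dvd_modulus_nat)
  hence "[a ^ (j * n) = a ^ Suc 0] (mod m)"
    by (simp only: order_divides_expdiff[OF am])
  thus ?thesis by (intro exI[of _ "a ^ j"]) (simp add: power_mult)
qed

lemma infinite_primes_cong_1_mod_prime:
  assumes r: "prime (r :: nat)"
  shows "infinite {p :: nat. prime p \<and> r dvd p - 1}"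
proof
  assume fin: "finite {p :: nat. prime p \<and> r dvd p - 1}"
  define x where "x = r * \<Prod>{p. prime p \<and> r dvd p - 1}"
  have x0: "x > 0" unfolding x_def using prime_gt_0_nat[OF r]
    by (intro mult_pos_pos prod_pos) (auto intro: prime_gt_0_nat)
  have "r \<ge> 2" using r by (rule prime_ge_2_nat)
  then obtain r' where r': "r = Suc (Suc r')" by (metis add_2_eq_Suc le_Suc_ex)
  define \<Phi> where "\<Phi> = (\<Sum>i<r. x ^ i)"
  have \<Phi>: "\<Phi> = 1 + x * (\<Sum>i<Suc r'. x ^ i)"
    unfolding \<Phi>_def r' by (subst sum.lessThan_Suc_shift) (simp add: sum_distrib_left distrib_left)
  have "\<Phi> \<noteq> 1" unfolding \<Phi> using x0 by (subst sum.lessThan_Suc_shift) simp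
  then obtain p where p: "prime p" "p dvd \<Phi>" using prime_factor_nat by blast
  have px: "\<not> p dvd x"
  proof
    assume "p dvd x"
    hence "p dvd 1" using p(2) unfolding \<Phi> by (metis dvd_add_left_iff dvd_mult2)
    thus False using p(1) by simp
  qed
  hence "coprime p x" using p(1) by (simp add: prime_imp_coprime)
  have "int p dvd (\<Sum>i<r. int x ^ i) * (int x - 1)"
  proof (rule dvd_mult2)
    have "int \<Phi> = (\<Sum>i<r. int x ^ i)" by (simp add: \<Phi>_def)
    thus "int p dvd (\<Sum>i<r. int x ^ i)" using p(2) by (metis int_dvd_int_iff)
  qed
  hence "[int x ^ r = 1] (mod int p)"
    using power_diff_1_eq[of "int x" r] by (simp add: cong_iff_dvd_diff mult.commute)
  hence xr: "[x ^ r = 1] (mod p)"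
    by (simp flip: cong_int_iff)
  hence "ord p x dvd r" by (simp add: ord_divides')
  hence "ord p x = 1 \<or> ord p x = r" using r by (simp add: prime_nat_iff)
  moreover have "ord p x \<noteq> 1"
  proof
    assume "ord p x = 1"
    hence x1: "[x = 1] (mod p)" by (metis ord power_one_right)
    have "[\<Phi> = (\<Sum>i<r. 1 ^ i)] (mod p)"
      unfolding \<Phi>_def by (intro cong_sum cong_pow x1)
    hence "[\<Phi> = r] (mod p)" by simp
    hence "p dvd r" using p(2) cong_dvd_iff by blast
    hence "p dvd x" unfolding x_def by simp
    thus False using px by simp
  qed
  ultimately have "ord p x = r" by simp
  hence "r dvd p - 1"
    using order_divides_totient[OF \<open>coprime p x\<close>] p(1) by (simp add: totient_prime)
  hence "p dvd x" unfolding x_def using p(1) fin by (intro dvd_mult dvd_prodI) auto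
  thus False using px by simp
qed

lemma multiplicity_pos:
  fixes p q :: nat
  shows "prime p \<Longrightarrow> p dvd q \<Longrightarrow> q > 0 \<Longrightarrow> multiplicity p q > 0"
  by (simp add: prime_multiplicity_gt_zero_iff)

lemma ex_nontrivial_root_of_unity_mod_prime_power:
  fixes p n v :: nat
  assumes p: "prime p" and np: "\<not> coprime n (p - 1)" and v: "v > 0"
  shows "\<exists>z. [z ^ n = 1] (mod p ^ v) \<and> \<not> [z = 1] (mod p ^ v)"
proof -
  have "p \<noteq> 2" using np by auto
  hence "odd p" using p primes_dvd_imp_eq two_is_prime_nat by blast
  then obtain g where "\<forall>k>0. residue_primroot (p ^ k) g"
    using residue_primroot_odd_prime_power_exists[OF p] by blast
  hence g: "ord (p ^ v) g = totient (p ^ v)"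
    using v by (simp add: residue_primroot_def)
  define t where "t = totient (p ^ v)"
  define d where "d = gcd n (p - 1)"
  have "p - 1 > 0" using prime_gt_1_nat[OF p] by simp
  have t0: "t > 0" using p by (simp add: t_def prime_gt_0_nat)
  have "d \<noteq> 0" using \<open>p - 1 > 0\<close> by (simp add: d_def)
  moreover have "d \<noteq> 1" using np unfolding d_def coprime_iff_gcd_eq_1 .
  ultimately have d: "d > 1" by linarith
  have "d dvd t" using p v unfolding d_def t_def by (simp add: totient_prime_power)
  then obtain u where u: "t = d * u" by blast
  have "d dvd n" by (simp add: d_def)
  hence "t dvd u * n" unfolding u mult.commute[of d] by (rule mult_dvd_mono[OF dvd_refl])
  hence "[(g ^ u) ^ n = 1] (mod p ^ v)"
    unfolding power_mult[symmetric] ord_divides g t_def .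
  moreover have "u < t" "u > 0" using u d t0 by auto
  hence "\<not> [g ^ u = 1] (mod p ^ v)"
    unfolding ord_divides g t_def[symmetric] by (simp add: nat_dvd_not_less)
  ultimately show ?thesis by blast
qed

lemma ex_root_of_unity_large_multiple:
  fixes m1 m2 n z0 :: nat
  assumes cop: "coprime m1 m2" and n: "coprime n m1"
    and z0: "[z0 ^ n = 1] (mod m1)" "\<not> [z0 = 1] (mod m1)"
  shows "\<exists>z :: int. [z ^ n = 1] (mod int (m1 * m2)) \<and>
    (\<forall>w. [w = int n * z] (mod int (m1 * m2)) \<longrightarrow> \<bar>w\<bar> \<ge> int m2 - int n)"
proof -
  obtain z where z1: "[z = z0] (mod m1)" and z2: "[z = 1] (mod m2)"
    using binary_chinese_remainder_nat[OF cop] by blast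
  have "[z ^ n = 1] (mod m1)" using cong_trans[OF cong_pow[OF z1] z0(1)] .
  moreover have "[z ^ n = 1] (mod m2)" using cong_pow[OF z2, of n] by simp
  ultimately have "[z ^ n = 1] (mod m1 * m2)"
    using cop by (rule coprime_cong_mult_nat)
  hence 1: "[int z ^ n = 1] (mod int (m1 * m2))"
    by (metis cong_int_iff of_nat_1 of_nat_power)
  have "\<bar>w\<bar> \<ge> int m2 - int n" if w: "[w = int n * int z] (mod int (m1 * m2))" for w
  proof -
    have w1: "[w = int n * int z] (mod int m1)" and w2: "[w = int n * int z] (mod int m2)"
      by (rule cong_dvd_modulus[OF w]; simp)+
    have "[int n * int z = int n * 1] (mod int m2)"
      using z2 by (intro cong_mult cong_refl) (metis cong_int_iff of_nat_1)
    hence "[w = int n] (mod int m2)" using cong_trans[OF w2] by simp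
    hence "int m2 dvd w - int n" by (simp add: cong_iff_dvd_diff)
    moreover have "w \<noteq> int n"
    proof
      assume "w = int n"
      hence "[int n * int z = int n * 1] (mod int m1)"
        using w1 by (simp add: cong_sym)
      hence "[int z = 1] (mod int m1)"
        using n by (subst (asm) cong_mult_lcancel) auto
      hence "[z = 1] (mod m1)" by (metis cong_int_iff of_nat_1)
      thus False using z0(2) z1 cong_sym cong_trans by blast
    qed
    ultimately have "int m2 \<le> \<bar>w - int n\<bar>"
      using dvd_imp_le_int[of "w - int n" "int m2"] by simp
    thus ?thesis by simp
  qed
  with 1 show ?thesis by blast
qed

lemma ex_small_prime_power_factor:
  fixes q k :: nat
  assumes q: "q > 0" and G: "G \<subseteq> prime_factors q" and k: "card G \<ge> k" "k > 0"
  shows "\<exists>p\<in>G. (p ^ multiplicity p q) ^ k \<le> q"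
proof (rule ccontr)
  assume "\<not> ?thesis"
  hence less: "q < (p ^ multiplicity p q) ^ k" if "p \<in> G" for p using that by force
  have fin: "finite G" using G finite_subset by blast
  obtain p0 where p0: "p0 \<in> G" using k by fastforce
  have "q ^ k \<le> q ^ card G" using q k by (intro power_increasing) auto
  also have "\<dots> = (\<Prod>p\<in>G. q)" by simp
  also have "\<dots> < (\<Prod>p\<in>G. (p ^ multiplicity p q) ^ k)"
    using p0 less[OF p0] fin
    by (rule prod_mono_strict) (auto intro: less_imp_le[OF less] le_less_trans[OF _ less])
  also have "\<dots> = (\<Prod>p\<in>G. p ^ multiplicity p q) ^ k" by (simp add: prod_power_distrib)
  also have "\<dots> \<le> q ^ k"
  proof (intro power_mono)
    have "(\<Prod>p\<in>G. p ^ multiplicity p q) dvd (\<Prod>p\<in>prime_factors q. p ^ multiplicity p q)"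
      using G by (intro prod_dvd_prod_subset) auto
    also have "\<dots> = q" using q prod_prime_factors[of q] by simp
    finally show "(\<Prod>p\<in>G. p ^ multiplicity p q) \<le> q" using q by (rule dvd_imp_le)
  qed simp
  finally show False by simp
qed

lemma nth_power_mod_if_prime_powers:
  fixes a q n :: nat
  assumes q: "q > 0"
    and local: "\<And>p. p \<in> prime_factors q \<Longrightarrow> \<exists>y. [y ^ n = a] (mod p ^ multiplicity p q)"
  shows "\<exists>y. [y ^ n = a] (mod q)"
proof -
  have cop: "coprime (p ^ multiplicity p q) (p' ^ multiplicity p' q)"
    if "p \<in> prime_factors q" "p' \<in> prime_factors q" "p \<noteq> p'" for p p'
    using that by (auto simp: in_prime_factors_iff intro!: coprime_power_left_iff[THEN iffD2] primes_coprime)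
  obtain f where f: "\<And>p. p \<in> prime_factors q \<Longrightarrow> [f p ^ n = a] (mod p ^ multiplicity p q)"
    using local by metis
  obtain y where y: "\<forall>p\<in>prime_factors q. [y = f p] (mod p ^ multiplicity p q)"
    using chinese_remainder_nat[of "prime_factors q" "\<lambda>p. p ^ multiplicity p q" f] cop by auto
  have "[y ^ n = a] (mod (\<Prod>p\<in>prime_factors q. p ^ multiplicity p q))"
    using cop f y by (intro coprime_cong_prod_nat) (auto intro: cong_trans[OF cong_pow])
  thus ?thesis using q prod_prime_factors[of q] by auto
qed

definition wild_primes :: "nat \<Rightarrow> nat \<Rightarrow> nat set" where
  "wild_primes n q = {p \<in> prime_factors q. \<not> p dvd n \<and> \<not> coprime n (p - 1)}"

lemma ex_pair_nth_power:
  fixes q n :: nat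
  assumes q: "q > 0" and n: "n > 0"
    and L: "finite L" "\<And>l. l \<in> L \<Longrightarrow> coprime l q"
    and card: "card L > n ^ 3 * n ^ card (wild_primes n q)"
  shows "\<exists>l\<in>L. \<exists>l'\<in>L. l \<noteq> l' \<and> (\<exists>y. [y ^ n = l * l' ^ (n - 1)] (mod q))"
proof -
  define G where "G = wild_primes n q"
  have fin: "finite G" by (simp add: G_def wild_primes_def)
  have "\<exists>i. [g ^ i = l] (mod m)" if "residue_primroot m g" "coprime l m" "m > 1"
    for m g l :: nat
  proof -
    have cop: "coprime (l mod m) m"
      using that by (subst coprime_mod_left_iff) auto
    have "l mod m \<noteq> 0"
    proof
      assume "l mod m = 0"
      with cop have "m = 1" by simp
      with that(3) show False by simp
    qed
    moreover have "0 < m" using that(3) by linarith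
    note mod_le_divisor[OF this, of l]
    ultimately have "l mod m \<in> totatives m"
      using cop by (simp add: totatives_def)
    also have "totatives m = (\<lambda>i. g ^ i mod m) ` {..<totient m}"
      using residue_primroot_is_generator[OF that(3,1)] by (simp add: bij_betw_def)
    finally show ?thesis by (auto simp: cong_def)
  qed
  moreover have "\<exists>g. residue_primroot (p ^ multiplicity p q) g" if "p \<in> G" for p
  proof -
    have p: "prime p" "\<not> coprime n (p - 1)" "p dvd q"
      using that by (auto simp: G_def wild_primes_def in_prime_factors_iff)
    hence "p \<noteq> 2" by auto
    hence "odd p" using p primes_dvd_imp_eq two_is_prime_nat by blast
    moreover have "multiplicity p q > 0" using p q by (intro multiplicity_pos)
    ultimately show ?thesis using residue_primroot_odd_prime_power_exists[OF p(1)] by metis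
  qed
  moreover have "coprime l (p ^ multiplicity p q)" "p ^ multiplicity p q > 1" if "p \<in> G" "l \<in> L" for p l
  proof -
    have p: "prime p" "p dvd q"
      using that by (auto simp: G_def wild_primes_def in_prime_factors_iff)
    show "coprime l (p ^ multiplicity p q)"
      using L(2)[OF that(2)] multiplicity_dvd[of p q] by (meson coprime_divisors dvd_refl)
    show "p ^ multiplicity p q > 1"
      using p q by (intro one_less_power prime_gt_1_nat multiplicity_pos)
  qed
  ultimately have "\<forall>p\<in>G. \<exists>g. \<forall>l\<in>L. \<exists>i. [g ^ i = l] (mod p ^ multiplicity p q)"
    by meson
  then obtain g ind where ind: "\<And>p l. p \<in> G \<Longrightarrow> l \<in> L \<Longrightarrow> [g p ^ ind p l = l] (mod p ^ multiplicity p q)"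
    by metis
  define label where "label = (\<lambda>l. (l mod n ^ 3, \<lambda>p\<in>G. ind p l mod n))"
  have "label ` L \<subseteq> {..<n ^ 3} \<times> (G \<rightarrow>\<^sub>E {..<n})"
    using n by (auto simp: label_def)
  hence "card (label ` L) \<le> card ({..<n ^ 3} \<times> (G \<rightarrow>\<^sub>E {..<n}))"
    by (intro card_mono finite_cartesian_product finite_PiE fin) auto
  also have "\<dots> < card L"
    using card fin by (simp add: card_cartesian_product card_PiE G_def)
  finally obtain l l' where l: "l \<in> L" "l' \<in> L" "l \<noteq> l'" and eq: "label l = label l'"
    using pigeonhole[of label L] unfolding inj_on_def by blast
  have mod3: "[l = l'] (mod n ^ 3)" using eq by (simp add: label_def cong_def)
  have modn: "[ind p l = ind p l'] (mod n)" if "p \<in> G" for p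
  proof -
    have "(\<lambda>p\<in>G. ind p l mod n) = (\<lambda>p\<in>G. ind p l' mod n)"
      using eq by (simp add: label_def)
    from fun_cong[OF this, of p] that show ?thesis by (simp add: cong_def)
  qed
  have "\<exists>y. [y ^ n = l * l' ^ (n - 1)] (mod p ^ multiplicity p q)" if pq: "p \<in> prime_factors q" for p
  proof -
    have p: "prime p" "p dvd q" using pq by (auto simp: in_prime_factors_iff)
    have cop: "coprime l p" "coprime l' p"
      using L(2) l p(2) by (meson coprime_divisors dvd_refl)+
    consider "p dvd n" | "p \<in> G" | "\<not> p dvd n" "coprime n (p - 1)"
      using pq by (auto simp: G_def wild_primes_def)
    thus ?thesis
    proof cases
      case 1
      have "[l * l' ^ (n - 1) = l' * l' ^ (n - 1)] (mod n ^ 3)"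
        using mod3 by (intro cong_mult cong_refl)
      also have "l' * l' ^ (n - 1) = l' ^ n" using n by (simp add: power_eq_if)
      finally have "[int (l * l' ^ (n - 1)) = int l' ^ n] (mod int (n ^ 3))"
        unfolding of_nat_power[symmetric] cong_int_iff .
      moreover have "\<not> int p dvd int l'"
        using cop p(1) not_coprimeI[of p l' p] by (auto simp: coprime_commute)
      ultimately obtain y where y: "[y ^ n = int (l * l' ^ (n - 1))] (mod int p ^ multiplicity p q)"
        using nth_power_mod_prime_power[OF p(1) n 1] by blast
      define y' where "y' = nat (y mod int p ^ multiplicity p q)"
      have "int y' = y mod int p ^ multiplicity p q"
        using p(1) by (simp add: y'_def prime_gt_0_nat)
      hence "[int y' = y] (mod int p ^ multiplicity p q)" by simp
      hence "[int y' ^ n = int (l * l' ^ (n - 1))] (mod int p ^ multiplicity p q)"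
        using cong_trans[OF cong_pow y] by blast
      hence "[y' ^ n = l * l' ^ (n - 1)] (mod p ^ multiplicity p q)"
        unfolding of_nat_power[symmetric] cong_int_iff .
      thus ?thesis ..
    next
      case 2
      let ?m = "p ^ multiplicity p q"
      have "[ind p l + (n - 1) * ind p l' = ind p l' + (n - 1) * ind p l'] (mod n)"
        using modn[OF 2] by (intro cong_add cong_refl)
      also have "ind p l' + (n - 1) * ind p l' = n * ind p l'"
        using n by (cases n) auto
      also have "[n * ind p l' = 0] (mod n)" by (simp add: cong_def)
      finally obtain t where t: "ind p l + (n - 1) * ind p l' = n * t"
        by (auto simp: cong_0_iff)
      have "[g p ^ ind p l * (g p ^ ind p l') ^ (n - 1) = l * l' ^ (n - 1)] (mod ?m)"
        using ind[OF 2] l by (intro cong_mult cong_pow) auto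
      also have "g p ^ ind p l * (g p ^ ind p l') ^ (n - 1) = g p ^ (ind p l + (n - 1) * ind p l')"
        by (simp add: power_add power_mult[symmetric] mult.commute)
      also have "\<dots> = (g p ^ t) ^ n" by (simp only: t power_mult[symmetric] mult.commute[of t])
      finally show ?thesis ..
    next
      case 3
      have "coprime n p" using prime_imp_coprime[OF p(1) 3(1)] coprime_commute by blast
      moreover have "multiplicity p q > 0" using p q by (intro multiplicity_pos)
      ultimately have "coprime n (totient (p ^ multiplicity p q))"
        using 3 p(1) by (simp add: totient_prime_power)
      thus ?thesis using cop p(1)
        by (intro nth_power_mod_coprime_totient) auto
    qed
  qed
  with nth_power_mod_if_prime_powers[OF q] l show ?thesis by blast
qed

lemma residue_abs_witness: "\<exists>w. [w = a] (mod int q) \<and> int (residue_abs q a) = \<bar>w\<bar>"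
proof -
  have "\<exists>m. \<exists>a'. [a' = a] (mod int q) \<and> m = nat \<bar>a'\<bar>" by (intro exI[of _ "nat \<bar>a\<bar>"] exI[of _ a]) simp
  from LeastI_ex[OF this] show ?thesis unfolding residue_abs_def by auto
qed

lemma residue_abs_le: "[w = a] (mod int q) \<Longrightarrow> int (residue_abs q a) \<le> \<bar>w\<bar>"
proof -
  assume "[w = a] (mod int q)"
  hence "residue_abs q a \<le> nat \<bar>w\<bar>" unfolding residue_abs_def by (intro Least_le) blast
  thus ?thesis by linarith
qed

lemma residue_abs_cong: "[a = b] (mod int q) \<Longrightarrow> residue_abs q a = residue_abs q b"
  unfolding residue_abs_def by (metis (no_types, opaque_lifting) cong_sym cong_trans)

section \<open>Independence of radicals\<close>

lemma norm_poly_0_eq_power_degree: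
  fixes f :: "complex poly"
  assumes "lead_coeff f = 1" and "\<And>z. poly f z = 0 \<Longrightarrow> norm z = y"
  shows "norm (poly f 0) = y ^ degree f"
proof -
  obtain root where root: "smult (lead_coeff f) (\<Prod>i<degree f. [:-root i, 1:]) = f"
    by (rule complex_poly_decompose')
  have "poly (smult (lead_coeff f) (\<Prod>i<degree f. [:-root i, 1:])) z = (\<Prod>i<degree f. z - root i)" for z
    by (simp add: poly_prod assms(1))
  hence eq: "poly f z = (\<Prod>i<degree f. z - root i)" for z
    unfolding root .
  have "norm (root i) = y" if "i < degree f" for i
    using that by (intro assms(2)) (auto simp: eq)
  thus ?thesis by (simp add: eq prod_norm[symmetric])
qed

text \<open>The minimal polynomial of \<open>y\<close> over \<open>K\<close> divides \<open>X\<^sup>n - y\<^sup>n\<close>, so all its complex roots have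
  absolute value \<open>y\<close> and its constant term is \<open>\<plusminus>y\<^sup>d\<close>, where \<open>d\<close> is its degree.\<close>

lemma real_radical_linear_independent:
  fixes K :: "real set" and y :: real
  assumes K: "1 \<in> K" "\<And>u v. u \<in> K \<Longrightarrow> v \<in> K \<Longrightarrow> u - v \<in> K"
      "\<And>u v. u \<in> K \<Longrightarrow> v \<in> K \<Longrightarrow> u * v \<in> K" "\<And>u. u \<in> K \<Longrightarrow> inverse u \<in> K"
    and y: "y > 0" "y ^ n \<in> K" "\<And>d. 0 < d \<Longrightarrow> d < n \<Longrightarrow> y ^ d \<notin> K"
    and p: "\<And>i. coeff p i \<in> K" "poly p y = 0" "degree p < n"
  shows "p = 0"
proof (rule ccontr)
  assume "p \<noteq> 0"
  have K0: "0 \<in> K" using K(2)[OF K(1) K(1)] by simp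
  have Kneg: "- u \<in> K" if "u \<in> K" for u using K(2)[OF K0 that] by simp
  define P where "P = (\<lambda>f. f \<noteq> 0 \<and> (\<forall>i. coeff f i \<in> K) \<and> poly f y = 0)"
  have "P p" using p \<open>p \<noteq> 0\<close> by (simp add: P_def)
  then obtain f0 where f0: "P f0" and f0_min: "\<And>g. P g \<Longrightarrow> degree f0 \<le> degree g"
    using ex_has_least_nat[of P p degree] by blast
  define f where "f = smult (inverse (lead_coeff f0)) f0"
  define d where "d = degree f"
  have nz: "lead_coeff f0 \<noteq> 0" using f0 by (simp add: P_def)
  hence d_eq: "d = degree f0" by (simp add: d_def f_def)
  have f_lead: "coeff f d = 1" using nz by (simp add: f_def d_eq)
  have f_K: "coeff f i \<in> K" for i using f0 K(3,4) by (simp add: f_def P_def)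
  have f_y: "poly f y = 0" using f0 by (simp add: f_def P_def)
  have f_min: "g = 0" if "\<And>i. coeff g i \<in> K" "poly g y = 0" "degree g < d" for g
    using f0_min[of g] that by (auto simp: P_def d_eq)
  have "d > 0"
  proof (rule ccontr)
    assume "\<not> d > 0"
    then obtain c where "f = [:c:]" using degree_eq_zeroE unfolding d_def by blast
    with f_y f_lead show False by (auto simp: d_def)
  qed
  have "d < n" using f0_min[OF \<open>P p\<close>] p(3) by (simp add: d_eq)
  have "\<exists>r. (\<forall>i. coeff r i \<in> K) \<and> degree r < d \<and> f dvd monom 1 m - r" for m
  proof (induction m)
    case 0
    show ?case by (rule exI[of _ 1]) (use \<open>d > 0\<close> K(1) K0 in \<open>auto simp: coeff_1\<close>)
  next
    case (Suc m)
    then obtain r where r: "\<And>i. coeff r i \<in> K" "degree r < d" "f dvd monom 1 m - r" by blast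
    define c where "c = coeff r (d - 1)"
    define r' where "r' = pCons 0 r - smult c f"
    have "coeff r' i \<in> K" for i
      using r(1) f_K K K0 by (auto simp: r'_def c_def coeff_pCons split: nat.split)
    moreover have "degree r' < d"
    proof (rule degree_lessI)
      show "r' \<noteq> 0 \<or> 0 < d" using \<open>d > 0\<close> by simp
      show "\<forall>i\<ge>d. coeff r' i = 0"
      proof (intro allI impI)
        fix i assume "i \<ge> d"
        then obtain j where j: "i = Suc j" using \<open>d > 0\<close> by (metis Suc_pred less_le_trans)
        show "coeff r' i = 0"
        proof (cases "i = d")
          case True
          hence "d = Suc j" using j by simp
          with f_lead show ?thesis by (simp add: r'_def c_def j)
        next
          case False
          hence "coeff f i = 0" "coeff r j = 0"
            using \<open>i \<ge> d\<close> r(2) j by (auto intro!: coeff_eq_0 simp: d_def)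
          thus ?thesis by (simp add: r'_def j)
        qed
      qed
    qed
    moreover have "monom 1 (Suc m) - r' = [:0, 1:] * (monom 1 m - r) + smult c f"
      by (simp add: r'_def monom_Suc algebra_simps)
    hence "f dvd monom 1 (Suc m) - r'"
      using r(3) by (metis dvd_add dvd_mult dvd_refl dvd_smult)
    ultimately show ?case by blast
  qed
  then obtain r where r: "\<And>i. coeff r i \<in> K" "degree r < d" "f dvd monom 1 n - r" by blast
  have "r - [:y ^ n:] = 0"
  proof (rule f_min)
    show "coeff (r - [:y ^ n:]) i \<in> K" for i
      using r(1) K(2) y(2) K0 by (auto simp: coeff_pCons split: nat.split)
    from r(3) f_y have "poly (monom 1 n - r) y = 0" by (metis dvdE mult_zero_left poly_mult)
    thus "poly (r - [:y ^ n:]) y = 0" by (simp add: poly_monom)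
    show "degree (r - [:y ^ n:]) < d" using r(2) \<open>d > 0\<close> by (intro degree_diff_less) auto
  qed
  with r(3) obtain h where h: "monom 1 n - [:y ^ n:] = f * h" by auto
  define F where "F = map_poly complex_of_real f"
  have map_mult: "map_poly complex_of_real (f * h) = map_poly complex_of_real f * map_poly complex_of_real h"
    by (rule poly_eqI) (simp add: coeff_map_poly coeff_mult)
  have "norm (poly F 0) = y ^ degree F"
  proof (rule norm_poly_0_eq_power_degree)
    show "lead_coeff F = 1" using f_lead by (simp add: F_def d_def degree_map_poly coeff_map_poly)
    fix z assume "poly F z = 0"
    hence "poly (map_poly complex_of_real (f * h)) z = 0"
      using arg_cong[OF map_mult, of "\<lambda>g. poly g z"] by (simp add: F_def)
    moreover have "map_poly complex_of_real (monom 1 n - [:y ^ n:]) = monom 1 n - [:complex_of_real (y ^ n):]"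
      by (rule poly_eqI) (simp add: coeff_map_poly coeff_pCons split: nat.split)
    ultimately have "z ^ n = complex_of_real (y ^ n)"
      unfolding h by (simp add: poly_monom)
    hence "norm z ^ n = y ^ n" using y(1)
      by (metis norm_of_real norm_power abs_of_pos zero_less_power)
    thus "norm z = y" using y(1) \<open>d < n\<close> by (intro power_eq_imp_eq_base[of "norm z" n y]) auto
  qed
  moreover have "poly F 0 = complex_of_real (coeff f 0)"
    by (simp add: F_def poly_0_coeff_0 coeff_map_poly)
  ultimately have "\<bar>coeff f 0\<bar> = y ^ d" by (simp add: F_def d_def degree_map_poly)
  hence "y ^ d \<in> K" using f_K[of 0] Kneg by (metis abs_if)
  thus False using y(3) \<open>d > 0\<close> \<open>d < n\<close> by blast
qed

context order_basis
begin

definition quot :: "real set" where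
  "quot = {x. \<exists>u N. N \<noteq> 0 \<and> of_int N * x = val u}"

lemma val_in_quot: "val u \<in> quot"
  unfolding quot_def by (auto intro!: exI[of _ u] exI[of _ 1])

lemma one_in_quot: "1 \<in> quot"
  using val_in_quot[of "\<lambda>e. if e = one then 1 else 0"] by (simp add: val_of_int)

lemma quot_diff: "x \<in> quot \<Longrightarrow> y \<in> quot \<Longrightarrow> x - y \<in> quot"
proof -
  assume "x \<in> quot" "y \<in> quot"
  then obtain u N v M where "N \<noteq> 0" "of_int N * x = val u" "M \<noteq> 0" "of_int M * y = val v"
    unfolding quot_def by auto
  hence "N * M \<noteq> 0" "of_int (N * M) * (x - y) = val (\<lambda>e. M * u e - N * v e)"
    by (simp_all add: val_diff val_scale algebra_simps)
  thus ?thesis unfolding quot_def by blast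
qed

lemma quot_mult: "x \<in> quot \<Longrightarrow> y \<in> quot \<Longrightarrow> x * y \<in> quot"
proof -
  assume "x \<in> quot" "y \<in> quot"
  then obtain u N v M where "N \<noteq> 0" "of_int N * x = val u" "M \<noteq> 0" "of_int M * y = val v"
    unfolding quot_def by auto
  moreover have "of_int (N * M) * (x * y) = (of_int N * x) * (of_int M * y)" by simp
  ultimately have "N * M \<noteq> 0" "of_int (N * M) * (x * y) = val (mul u v)"
    by (simp_all only: val_mul mult_eq_0_iff simp_thms)
  thus ?thesis unfolding quot_def by blast
qed

lemma quot_inverse: "x \<in> quot \<Longrightarrow> inverse x \<in> quot"
proof (cases "x = 0")
  case False
  assume "x \<in> quot"
  then obtain u N where u: "N \<noteq> 0" "of_int N * x = val u" unfolding quot_def by auto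
  with False have "val u \<noteq> 0" by (metis mult_eq_0_iff of_int_eq_0_iff)
  then obtain v M where v: "M \<noteq> 0" "val u * val v = of_int M" using ex_int_multiple by blast
  have "of_int M * inverse x = val (\<lambda>e. N * v e)"
    unfolding v(2)[symmetric] u(2)[symmetric] using False by (simp add: val_scale)
  thus ?thesis using v(1) unfolding quot_def by blast
qed simp

lemma adjoin_radical_linear_independent:
  assumes y: "y > 0" "y ^ n \<in> quot" "\<And>d. 0 < d \<Longrightarrow> d < n \<Longrightarrow> y ^ d \<notin> quot"
    and x: "(\<Sum>t<n. val (x t) * y ^ t) = 0" and t: "t < n"
  shows "val (x t) = 0"
proof -
  define p where "p = (\<Sum>t<n. monom (val (x t)) t)"
  have coeff: "coeff p i = (if i < n then val (x i) else 0)" for i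
    by (simp add: p_def coeff_sum)
  have "p = 0"
  proof (rule real_radical_linear_independent[OF one_in_quot quot_diff quot_mult quot_inverse y])
    show "coeff p i \<in> quot" for i
      using val_in_quot quot_diff[OF one_in_quot one_in_quot] by (simp add: coeff)
    show "poly p y = 0" using x by (simp add: p_def poly_sum poly_monom)
    show "degree p < n" using t by (intro degree_lessI) (auto simp: coeff)
  qed auto
  with coeff[of t] t show ?thesis by simp
qed

definition ord_ring :: "real set" where
  "ord_ring = range val"

lemma ord_ring_add: "u \<in> ord_ring \<Longrightarrow> v \<in> ord_ring \<Longrightarrow> u + v \<in> ord_ring"
  unfolding ord_ring_def by (auto simp flip: val_add)

lemma ord_ring_mult: "u \<in> ord_ring \<Longrightarrow> v \<in> ord_ring \<Longrightarrow> u * v \<in> ord_ring"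
  unfolding ord_ring_def by (auto simp flip: val_mul)

lemma ord_ring_of_int: "of_int m \<in> ord_ring"
  unfolding ord_ring_def by (metis val_of_int rangeI)

lemma ord_ring_of_nat: "of_nat m \<in> ord_ring"
  using ord_ring_of_int[of "int m"] by simp

lemma ord_ring_power: "u \<in> ord_ring \<Longrightarrow> u ^ m \<in> ord_ring"
  by (induction m) (use ord_ring_of_int[of 1] in \<open>auto intro: ord_ring_mult\<close>)

lemma ord_ring_sum: "(\<And>i. i \<in> F \<Longrightarrow> f i \<in> ord_ring) \<Longrightarrow> sum f F \<in> ord_ring"
  by (induction F rule: infinite_finite_induct) (use ord_ring_of_int[of 0] in \<open>auto intro: ord_ring_add\<close>)

lemma ord_ring_b:
  assumes "e \<in> E"
  shows "b e \<in> ord_ring"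
proof -
  have "val (\<lambda>f. if f = e then 1 else 0) = (\<Sum>f\<in>E. if f = e then b e else 0)"
    unfolding val_def by (intro sum.cong) auto
  also have "\<dots> = b e" using assms finite_E by simp
  finally show ?thesis unfolding ord_ring_def by (metis rangeI)
qed

lemma add_power_prime:
  assumes p: "prime p" and uv: "u \<in> ord_ring" "v \<in> ord_ring"
  shows "\<exists>w\<in>ord_ring. (u + v) ^ p = u ^ p + v ^ p + of_nat p * w"
proof (rule bexI)
  let ?w = "\<Sum>i\<in>{1..<p}. of_int (int ((p choose i) div p)) * (u ^ i * v ^ (p - i))"
  show "?w \<in> ord_ring"
    by (intro ord_ring_sum ord_ring_mult ord_ring_power ord_ring_of_int uv)
  have "p > 0" using p by (rule prime_gt_0_nat)
  hence "{..p} = insert 0 (insert p {1..<p})" by auto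
  hence "(u + v) ^ p = u ^ p + v ^ p + (\<Sum>i\<in>{1..<p}. of_nat (p choose i) * u ^ i * v ^ (p - i))"
    unfolding binomial_ring using \<open>p > 0\<close> by simp
  also have "(\<Sum>i\<in>{1..<p}. of_nat (p choose i) * u ^ i * v ^ (p - i)) = of_nat p * ?w"
    unfolding sum_distrib_left
  proof (rule sum.cong)
    fix i assume "i \<in> {1..<p}"
    hence "p dvd p choose i" using p by (intro dvd_choose_prime) auto
    hence "real (p choose i) = of_nat p * real ((p choose i) div p)"
      by (metis dvd_mult_div_cancel of_nat_mult)
    thus "real (p choose i) * u ^ i * v ^ (p - i) =
        of_nat p * (of_int (int ((p choose i) div p)) * (u ^ i * v ^ (p - i)))"
      by simp
  qed simp
  finally show "(u + v) ^ p = u ^ p + v ^ p + of_nat p * ?w" .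
qed

lemma sum_power_prime:
  assumes p: "prime p" and "finite F" and "\<And>i. i \<in> F \<Longrightarrow> f i \<in> ord_ring"
  shows "\<exists>w\<in>ord_ring. (\<Sum>i\<in>F. f i) ^ p = (\<Sum>i\<in>F. f i ^ p) + of_nat p * w"
  using assms(2,3)
proof (induction F rule: finite_induct)
  case empty
  show ?case using ord_ring_of_int[of 0] p by (auto intro!: bexI[of _ 0] simp: prime_gt_0_nat)
next
  case (insert i F)
  then obtain w where w: "w \<in> ord_ring" "(\<Sum>i\<in>F. f i) ^ p = (\<Sum>i\<in>F. f i ^ p) + of_nat p * w"
    by auto
  obtain w' where w': "w' \<in> ord_ring"
      "(f i + (\<Sum>i\<in>F. f i)) ^ p = f i ^ p + (\<Sum>i\<in>F. f i) ^ p + of_nat p * w'"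
    using add_power_prime[OF p, of "f i" "\<Sum>i\<in>F. f i"] insert.prems ord_ring_sum[of F f] by auto
  show ?case
    using insert.hyps w w' by (intro bexI[of _ "w + w'"]) (auto simp: algebra_simps intro: ord_ring_add)
qed

lemma sum_power_prime_power:
  assumes p: "prime p" and "finite F" and f: "\<And>i. i \<in> F \<Longrightarrow> f i \<in> ord_ring"
  shows "\<exists>w\<in>ord_ring. (\<Sum>i\<in>F. f i) ^ (p ^ j) = (\<Sum>i\<in>F. f i ^ (p ^ j)) + of_nat p * w"
proof (induction j)
  case 0
  show ?case using ord_ring_of_int[of 0] by (auto intro!: bexI[of _ 0])
next
  case (Suc j)
  have "p > 0" using p by (rule prime_gt_0_nat)
  let ?s = "\<Sum>i\<in>F. f i ^ (p ^ j)"
  from Suc obtain w where w: "w \<in> ord_ring" "(\<Sum>i\<in>F. f i) ^ (p ^ j) = ?s + of_nat p * w" by blast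
  have pw: "of_nat p * w \<in> ord_ring" by (intro ord_ring_mult ord_ring_of_nat w(1))
  have fj: "f i ^ (p ^ j) \<in> ord_ring" if "i \<in> F" for i
    using f[OF that] by (rule ord_ring_power)
  have "\<exists>w1\<in>ord_ring. ?s ^ p = (\<Sum>i\<in>F. (f i ^ (p ^ j)) ^ p) + of_nat p * w1"
    by (rule sum_power_prime[OF p assms(2)]) (rule fj)
  then obtain w1 where w1: "w1 \<in> ord_ring" "?s ^ p = (\<Sum>i\<in>F. (f i ^ (p ^ j)) ^ p) + of_nat p * w1"
    by (elim bexE)
  have "?s \<in> ord_ring" by (rule ord_ring_sum) (rule fj)
  from add_power_prime[OF p this pw]
  obtain w2 where w2: "w2 \<in> ord_ring"
      "(?s + of_nat p * w) ^ p = ?s ^ p + (of_nat p * w) ^ p + of_nat p * w2"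
    by (elim bexE)
  have "(of_nat p * w) ^ p = of_nat p * (w * (of_nat p * w) ^ (p - 1))"
    using \<open>p > 0\<close> by (cases p) auto
  hence "(\<Sum>i\<in>F. f i) ^ (p ^ Suc j) = (\<Sum>i\<in>F. f i ^ (p ^ Suc j)) +
      of_nat p * (w1 + w2 + w * (of_nat p * w) ^ (p - 1))"
    unfolding power_Suc2 power_mult w(2) w2(2) w1(2) by (simp only: distrib_left add_ac)
  moreover have "w1 + w2 + w * (of_nat p * w) ^ (p - 1) \<in> ord_ring"
    using w(1) w1(1) w2(1) by (intro ord_ring_add ord_ring_mult ord_ring_power ord_ring_of_nat)
  ultimately show ?case by blast
qed

lemma of_int_eq_scale_val_imp_dvd:
  assumes "of_int m = of_int k * val z"
  shows "k dvd m"
proof -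
  have "val (\<lambda>e. if e = one then m else 0) = val (\<lambda>e. k * z e)"
    using assms by (simp add: val_of_int val_scale)
  hence "m = k * z one" unfolding val_eq_iff using one_in by auto
  thus ?thesis by simp
qed

text \<open>Here \<open>b e ^ p ^ j\<close> being a unit multiple of \<open>b e\<close> modulo \<open>p\<close> expresses that \<open>p\<close> is unramified,
  that is, \<open>ord_ring\<close> modulo \<open>p\<close> is reduced.\<close>

lemma unramified_imp_reduced:
  assumes p: "prime p" and n: "n \<le> p ^ j"
    and A: "\<And>e. e \<in> E \<Longrightarrow> b e ^ (p ^ j) = of_int (A e) * b e"
    and pA: "\<And>e. e \<in> E \<Longrightarrow> \<not> int p dvd A e"
    and u: "val u ^ n = of_nat p * w" "w \<in> ord_ring"
  shows "\<exists>u'. val u = of_nat p * val u'"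
proof -
  have "val u ^ (p ^ j) = val u ^ n * val u ^ (p ^ j - n)"
    using n by (simp flip: power_add)
  hence 1: "val u ^ (p ^ j) = of_nat p * (w * val u ^ (p ^ j - n))"
    using u(1) by simp
  have "\<exists>w'\<in>ord_ring. (\<Sum>e\<in>E. of_int (u e) * b e) ^ (p ^ j) =
      (\<Sum>e\<in>E. (of_int (u e) * b e) ^ (p ^ j)) + of_nat p * w'"
    by (rule sum_power_prime_power[OF p finite_E]) (intro ord_ring_mult ord_ring_of_int ord_ring_b)
  then obtain w' where w': "w' \<in> ord_ring"
      "(\<Sum>e\<in>E. of_int (u e) * b e) ^ (p ^ j) = (\<Sum>e\<in>E. (of_int (u e) * b e) ^ (p ^ j)) + of_nat p * w'"
    by (elim bexE)
  have "(\<Sum>e\<in>E. (of_int (u e) * b e) ^ (p ^ j)) = val (\<lambda>e. u e ^ (p ^ j) * A e)"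
    unfolding val_def by (intro sum.cong) (auto simp: power_mult_distrib A)
  hence 2: "val (\<lambda>e. u e ^ (p ^ j) * A e) = of_nat p * (w * val u ^ (p ^ j - n) - w')"
    using 1 w'(2) unfolding val_def by (simp add: algebra_simps)
  have "w * val u ^ (p ^ j - n) + of_int (-1) * w' \<in> ord_ring"
    using u(2) w'(1) by (intro ord_ring_add ord_ring_mult ord_ring_power ord_ring_of_int)
      (auto simp: ord_ring_def)
  then obtain z where "w * val u ^ (p ^ j - n) - w' = val z"
    by (auto simp: ord_ring_def)
  with 2 have "val (\<lambda>e. u e ^ (p ^ j) * A e) = val (\<lambda>e. int p * z e)"
    by (simp add: val_scale)
  hence "u e ^ (p ^ j) * A e = int p * z e" if "e \<in> E" for e
    using that unfolding val_eq_iff by blast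
  hence "int p dvd u e ^ (p ^ j) * A e" if "e \<in> E" for e using that by simp
  hence dvd: "int p dvd u e" if "e \<in> E" for e
    using that pA p by (meson prime_dvd_multD prime_dvd_power prime_nat_int_transfer)
  have "val u = val (\<lambda>e. int p * (u e div int p))"
    unfolding val_eq_iff using dvd by simp
  thus ?thesis unfolding val_scale by (intro exI[of _ "\<lambda>e. u e div int p"]) simp
qed

lemma radical_power_notin_quot:
  assumes p: "prime p" and n: "n \<le> p ^ j"
    and A: "\<And>e. e \<in> E \<Longrightarrow> b e ^ (p ^ j) = of_int (A e) * b e"
    and pA: "\<And>e. e \<in> E \<Longrightarrow> \<not> int p dvd A e"
    and y: "y ^ n = of_nat a" and a: "p dvd a" "\<not> p ^ 2 dvd a"
    and d: "0 < d" "d < n"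
  shows "y ^ d \<notin> quot"
proof
  assume "y ^ d \<in> quot"
  then obtain N u where "N \<noteq> 0" "of_int N * y ^ d = val u" unfolding quot_def by blast
  thus False
  proof (induction "nat \<bar>N\<bar>" arbitrary: N u rule: less_induct)
    case less
    obtain a' where a': "a = p * a'" using a(1) by blast
    have pa': "\<not> p dvd a'" using a(2) by (auto simp: a' power2_eq_square)
    have "val u ^ n = of_int N ^ n * (y ^ n) ^ d"
      unfolding less.prems(2)[symmetric] by (simp add: power_mult_distrib mult.commute flip: power_mult)
    hence un: "val u ^ n = of_int (N ^ n * int a ^ d)" by (simp add: y)
    also have "N ^ n * int a ^ d = int p * (int a' * (N ^ n * int a ^ (d - 1)))"
      using d(1) by (cases d) (auto simp: a')
    finally have "val u ^ n = of_nat p * of_int (int a' * (N ^ n * int a ^ (d - 1)))" by simp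
    from unramified_imp_reduced[OF p n A pA this ord_ring_of_int]
    obtain u' where u': "val u = of_nat p * val u'" by blast
    have "val u' ^ n \<in> ord_ring" by (intro ord_ring_power) (simp add: ord_ring_def)
    then obtain z where "val u' ^ n = val z" by (auto simp: ord_ring_def)
    hence "of_int (N ^ n * int a ^ d) = of_int (int p ^ n) * val z"
      unfolding un[symmetric] u' by (simp add: power_mult_distrib)
    hence dvd: "int p ^ n dvd N ^ n * int a ^ d" by (rule of_int_eq_scale_val_imp_dvd)
    have pp: "prime (int p)" using p by simp
    have "int p dvd N"
    proof (rule ccontr)
      assume "\<not> int p dvd N"
      hence "coprime (int p ^ n) (N ^ n)" using pp by (simp add: prime_imp_coprime)
      with dvd have "int p ^ n dvd int a ^ d" by (simp add: coprime_dvd_mult_right_iff)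
      moreover have "int p ^ n = int p ^ d * int p ^ (n - d)" using d by (simp flip: power_add)
      ultimately have "int p ^ (n - d) dvd int a' ^ d"
        using p by (simp add: a' power_mult_distrib)
      moreover have "int p dvd int p ^ (n - d)" using d by (simp add: dvd_power)
      ultimately have "int p dvd int a' ^ d" by (rule dvd_trans[rotated])
      hence "int p dvd int a'" using pp prime_dvd_power by blast
      thus False using pa' by simp
    qed
    then obtain N' where N': "N = int p * N'" by blast
    have "of_int N' * y ^ d = val u'" using less.prems(2) p unfolding N' u' by simp
    moreover have "N' \<noteq> 0" using less.prems(1) N' by auto
    moreover have "nat \<bar>N'\<bar> < nat \<bar>N\<bar>"
      using \<open>N' \<noteq> 0\<close> prime_gt_1_nat[OF p] by (simp add: N' abs_mult)
    ultimately show False using less.hyps by blast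
  qed
qed

end

definition exps :: "nat \<Rightarrow> nat \<Rightarrow> (nat \<Rightarrow> nat) set" where
  "exps n s = {..<s} \<rightarrow>\<^sub>E {..<n}"

definition radprod :: "nat \<Rightarrow> (nat \<Rightarrow> 'a::comm_semiring_1) \<Rightarrow> (nat \<Rightarrow> nat) \<Rightarrow> 'a" where
  "radprod s y e = (\<Prod>i<s. y i ^ e i)"

definition exp_add :: "nat \<Rightarrow> nat \<Rightarrow> (nat \<Rightarrow> nat) \<Rightarrow> (nat \<Rightarrow> nat) \<Rightarrow> nat \<Rightarrow> nat" where
  "exp_add n s e f = (\<lambda>i\<in>{..<s}. (e i + f i) mod n)"

definition carry :: "nat \<Rightarrow> nat \<Rightarrow> (nat \<Rightarrow> 'a::comm_semiring_1) \<Rightarrow> (nat \<Rightarrow> nat) \<Rightarrow> (nat \<Rightarrow> nat) \<Rightarrow> 'a" where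
  "carry n s a e f = (\<Prod>i<s. a i ^ ((e i + f i) div n))"

lemma finite_exps: "finite (exps n s)"
  by (simp add: exps_def finite_PiE)

lemma card_exps: "card (exps n s) = n ^ s"
  by (simp add: exps_def card_PiE)

lemma radprod_mult:
  "radprod s y e * radprod s y f = carry n s (\<lambda>i. y i ^ n) e f * radprod s y (exp_add n s e f)"
proof -
  have "y i ^ e i * y i ^ f i = (y i ^ n) ^ ((e i + f i) div n) * y i ^ ((e i + f i) mod n)" for i
    by (simp flip: power_add power_mult)
  thus ?thesis
    by (simp add: radprod_def carry_def exp_add_def flip: prod.distrib)
qed

lemma radprod_power: "radprod s y e ^ n = radprod s (\<lambda>i. y i ^ n) e"
  by (simp add: radprod_def prod_power_distrib power_mult[symmetric] mult.commute)

lemma radprod_Suc: "radprod (Suc s) y (e(s := t)) = radprod s y e * y s ^ t"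
  unfolding radprod_def prod.lessThan_Suc by (intro arg_cong2[of _ _ _ _ "(*)"] prod.cong) auto

lemma sum_exps_Suc:
  fixes g :: "(nat \<Rightarrow> nat) \<Rightarrow> 'a::comm_monoid_add"
  shows "(\<Sum>e\<in>exps n (Suc s). g e) = (\<Sum>t<n. \<Sum>e\<in>exps n s. g (e(s := t)))"
proof -
  have "exps n (Suc s) = (\<lambda>(t, e). e(s := t)) ` ({..<n} \<times> exps n s)"
    unfolding exps_def lessThan_Suc by (rule PiE_insert_eq)
  moreover have "inj_on (\<lambda>(t, e). e(s := t)) ({..<n} \<times> exps n s)"
    using inj_combinator[of s "{..<s}" "\<lambda>_. {..<n}"] by (simp add: exps_def)
  ultimately show ?thesis
    by (simp add: sum.reindex sum.cartesian_product case_prod_unfold)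
qed

lemma of_nat_radprod: "radprod s (\<lambda>i. of_nat (a i)) e = of_nat (radprod s a e)"
  by (simp add: radprod_def)

lemma ex_prime_power_cong_1:
  fixes p n :: nat
  assumes p: "prime p" and n: "n > 0" "\<not> p dvd n"
  shows "\<exists>j t. p ^ j = 1 + n * t \<and> n \<le> p ^ j"
proof -
  have cop: "coprime p n" using p n(2) by (rule prime_imp_coprime)
  define P where "P = p ^ totient n"
  have "P > 1" unfolding P_def using p n(1) by (intro one_less_power prime_gt_1_nat) auto
  moreover have "[P = 1] (mod n)" unfolding P_def using cop by (rule euler_theorem)
  ultimately have "n dvd P - 1" by (metis cong_altdef_nat less_imp_le)
  then obtain t where t: "P - 1 = n * t" by blast
  with \<open>P > 1\<close> have "t \<noteq> 0" by (cases t) auto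
  with t \<open>P > 1\<close> have "P = 1 + n * t" "n \<le> P" by (cases t; simp)+
  thus ?thesis unfolding P_def by blast
qed

lemma order_basis_radicals:
  fixes a p :: "nat \<Rightarrow> nat"
  assumes n: "n > 0"
    and p: "\<And>i. i < s \<Longrightarrow> prime (p i)" "\<And>i. i < s \<Longrightarrow> \<not> p i dvd n"
    and a: "\<And>i. i < s \<Longrightarrow> p i dvd a i" "\<And>i. i < s \<Longrightarrow> \<not> (p i)\<^sup>2 dvd a i"
      "\<And>i j. i < s \<Longrightarrow> j < i \<Longrightarrow> \<not> p i dvd a j"
  shows "order_basis (exps n s) (exp_add n s) (carry n s (\<lambda>i. int (a i))) (\<lambda>i\<in>{..<s}. 0)
    (radprod s (\<lambda>i. root n (real (a i))))"
  using p a
proof (induction s)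
  case 0
  show ?case
    by unfold_locales
      (auto simp: exps_def exp_add_def carry_def radprod_def PiE_iff extensional_def restrict_def)
next
  case (Suc s)
  define y where "y = (\<lambda>i. root n (real (a i)))"
  interpret B: order_basis "exps n s" "exp_add n s" "carry n s (\<lambda>i. int (a i))" "\<lambda>i\<in>{..<s}. 0"
      "radprod s y"
    unfolding y_def by (rule Suc.IH) (use Suc.prems in auto)
  have yn: "y i ^ n = real (a i)" for i
    unfolding y_def using n by simp
  let ?p = "p s"
  have ps: "prime ?p" "\<not> ?p dvd n" "?p dvd a s" "\<not> ?p\<^sup>2 dvd a s" using Suc.prems by auto
  obtain j t where j: "?p ^ j = 1 + n * t" "n \<le> ?p ^ j"
    using ex_prime_power_cong_1[OF ps(1) n ps(2)] by blast
  have pow: "radprod s y e ^ (?p ^ j) = of_int (int (radprod s a e ^ t)) * radprod s y e" for e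
  proof -
    have "radprod s y e ^ (?p ^ j) = (radprod s y e ^ n) ^ t * radprod s y e"
      by (simp add: j(1) power_add power_mult)
    thus ?thesis by (simp add: radprod_power yn of_nat_radprod)
  qed
  have unit: "\<not> int ?p dvd int (radprod s a e ^ t)" for e
  proof
    assume "int ?p dvd int (radprod s a e ^ t)"
    hence "?p dvd radprod s a e" using ps(1) prime_dvd_power by (metis int_dvd_int_iff)
    then obtain i where "i < s" "?p dvd a i ^ e i"
      using ps(1) by (auto simp: radprod_def prime_dvd_prod_iff)
    thus False using Suc.prems(5)[of s i] ps(1) prime_dvd_power by blast
  qed
  have "y s > 0" using ps(4) n unfolding y_def by (intro real_root_gt_zero) (auto intro: Nat.gr0I)
  have ys: "y s ^ n \<in> B.quot"
    using B.val_in_quot[of "\<lambda>e. if e = (\<lambda>i\<in>{..<s}. 0) then int (a s) else 0"]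
    by (simp add: B.val_of_int yn)
  have notin: "y s ^ d \<notin> B.quot" if "0 < d" "d < n" for d
    using B.radical_power_notin_quot[OF ps(1) j(2) pow unit yn ps(3,4) that] .
  show ?case unfolding y_def[symmetric]
  proof unfold_locales
    show "finite (exps n (Suc s))" by (rule finite_exps)
    show "(\<lambda>i\<in>{..<Suc s}. 0) \<in> exps n (Suc s)" using n by (auto simp: exps_def)
    show "exp_add n (Suc s) e f \<in> exps n (Suc s)" for e f
      using n by (auto simp: exps_def exp_add_def)
    show "radprod (Suc s) y (\<lambda>i\<in>{..<Suc s}. 0) = 1" by (simp add: radprod_def)
    show "radprod (Suc s) y e * radprod (Suc s) y f =
        of_int (carry n (Suc s) (\<lambda>i. int (a i)) e f) * radprod (Suc s) y (exp_add n (Suc s) e f)" for e f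
      unfolding radprod_mult[of "Suc s" y e f n] by (simp add: carry_def yn)
    fix x :: "(nat \<Rightarrow> nat) \<Rightarrow> int" and e
    assume 0: "(\<Sum>e\<in>exps n (Suc s). of_int (x e) * radprod (Suc s) y e) = 0" and e: "e \<in> exps n (Suc s)"
    have sum0: "(\<Sum>t<n. B.val (\<lambda>e. x (e(s := t))) * y s ^ t) = 0"
      using 0 unfolding sum_exps_Suc radprod_Suc B.val_def by (simp add: sum_distrib_right mult.assoc)
    have val0: "B.val (\<lambda>e. x (e(s := t))) = 0" if "t < n" for t
    proof (rule B.adjoin_radical_linear_independent[where x = "\<lambda>t e. x (e(s := t))" and t = t])
      show "y s ^ d \<notin> B.quot" if "0 < d" "d < n" for d using that by (rule notin)
    qed (rule \<open>y s > 0\<close> ys sum0 that)+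
    have e_less: "e i < n" if "i < Suc s" for i
      using PiE_mem[OF e[unfolded exps_def], of i] that by simp
    hence "e s < n" by blast
    note sum_0 = val0[OF this, unfolded B.val_def]
    have mem: "restrict e {..<s} \<in> exps n s"
      unfolding exps_def
    proof (rule restrict_PiE_iff[THEN iffD2], rule ballI)
      fix i assume "i \<in> {..<s}"
      thus "e i \<in> {..<n}" using e_less[of i] by simp
    qed
    have "x ((restrict e {..<s})(s := e s)) = 0"
      using B.indep[of "\<lambda>e'. x (e'(s := e s))", OF sum_0 mem] .
    moreover have "(restrict e {..<s})(s := e s) = e"
      using e by (auto simp: exps_def fun_eq_iff PiE_iff extensional_def restrict_def)
    ultimately show "x e = 0" by simp
  qed
qed

lemma ex_small_integer_relation:
  fixes v :: "'i \<Rightarrow> int"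
  assumes E: "finite E" and v: "\<And>e. e \<in> E \<Longrightarrow> \<bar>v e\<bar> \<le> int B"
    and X: "2 * card E * X * B + 1 < (X + 1) ^ card E"
  shows "\<exists>x. (\<exists>e\<in>E. x e \<noteq> 0) \<and> (\<forall>e\<in>E. \<bar>x e\<bar> \<le> int X) \<and> (\<Sum>e\<in>E. x e * v e) = 0"
proof -
  define Y where "Y = E \<rightarrow>\<^sub>E {0..int X}"
  define R where "R = int (card E * X * B)"
  define h where "h = (\<lambda>x. \<Sum>e\<in>E. x e * v e)"
  have Y: "0 \<le> x e" "x e \<le> int X" if "x \<in> Y" "e \<in> E" for x e
  proof -
    have "x e \<in> {0..int X}" using that unfolding Y_def by (rule PiE_mem)
    thus "0 \<le> x e" "x e \<le> int X" by auto
  qed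
  have "h ` Y \<subseteq> {-R..R}"
  proof (rule image_subsetI)
    fix x assume x: "x \<in> Y"
    have "\<bar>h x\<bar> \<le> (\<Sum>e\<in>E. \<bar>x e * v e\<bar>)" unfolding h_def by (rule sum_abs)
    also have "\<dots> \<le> (\<Sum>e\<in>E. int X * int B)"
      unfolding abs_mult using Y[OF x] v by (intro sum_mono mult_mono) auto
    also have "\<dots> = R" by (simp add: R_def)
    finally show "h x \<in> {-R..R}" by auto
  qed
  hence "card (h ` Y) \<le> card {-R..R}" by (intro card_mono) auto
  also have "\<dots> = 2 * card E * X * B + 1" unfolding R_def card_atLeastAtMost_int by (simp add: nat_add_distrib nat_mult_distrib)
  also have "\<dots> < card Y"
    using X E by (simp add: Y_def card_PiE nat_add_distrib)
  finally obtain x x' where x: "x \<in> Y" "x' \<in> Y" "x \<noteq> x'" "h x = h x'"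
    using pigeonhole[of h Y] unfolding inj_on_def by blast
  have "\<exists>e\<in>E. x e \<noteq> x' e"
    using x(1-3) unfolding Y_def by (metis PiE_ext)
  moreover have "\<bar>x e - x' e\<bar> \<le> int X" if "e \<in> E" for e
    using Y[OF x(1) that] Y[OF x(2) that] by linarith
  moreover have "(\<Sum>e\<in>E. (x e - x' e) * v e) = 0"
    using x(4) by (simp add: h_def left_diff_distrib sum_subtractf)
  ultimately show ?thesis by (intro exI[of _ "\<lambda>e. x e - x' e"]) auto
qed

lemma (in order_basis) ex_large_residue:
  fixes q n M K :: nat and \<beta> :: "'i \<Rightarrow> int" and C :: real
  assumes \<beta>_one: "\<beta> one = 1"
    and \<beta>_mult: "\<And>e f. e \<in> E \<Longrightarrow> f \<in> E \<Longrightarrow> [\<beta> e * \<beta> f = c e f * \<beta> (op e f)] (mod int q)"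
    and M: "\<And>e f. e \<in> E \<Longrightarrow> f \<in> E \<Longrightarrow> \<bar>c e f\<bar> \<le> int M"
    and n: "n > 0"
    and K: "K = (2 * (card E ^ 2 * (n * M) + 1)) ^ card E"
    and q: "q > 2 * K" and C: "C \<ge> 4 * real (card E) * real K"
  shows "\<exists>e\<in>E. real (residue_abs q (int n * \<beta> e)) > inverse C * real q powr (1 - 1 / real (card E))"
proof (rule ccontr)
  assume neg: "\<not> ?thesis"
  define D where "D = card E"
  have D: "D > 0" unfolding D_def using one_in finite_E card_gt_0_iff by blast
  have K0: "K > 0" unfolding K by simp
  have q0: "q > 0" using q by simp
  have "C > 0" using C D K0 unfolding D_def[symmetric]
    by (smt (verit) mult_pos_pos of_nat_0_less_iff)
  define L where "L = inverse C * real q powr (1 - 1 / real D)"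
  define B where "B = nat \<lfloor>L\<rfloor>"
  have "L \<ge> 0" using \<open>C > 0\<close> by (simp add: L_def)
  have "\<exists>w. [w = int n * \<beta> e] (mod int q) \<and> int (residue_abs q (int n * \<beta> e)) = \<bar>w\<bar>" for e
    by (rule residue_abs_witness)
  then obtain v where v: "\<And>e. [v e = int n * \<beta> e] (mod int q)"
      "\<And>e. int (residue_abs q (int n * \<beta> e)) = \<bar>v e\<bar>"
    by metis
  have vB: "\<bar>v e\<bar> \<le> int B" if "e \<in> E" for e
  proof -
    have "real (residue_abs q (int n * \<beta> e)) \<le> L"
      using neg that unfolding L_def D_def by (simp add: not_less)
    hence "int (residue_abs q (int n * \<beta> e)) \<le> \<lfloor>L\<rfloor>" by (simp add: le_floor_iff)
    thus ?thesis using v(2)[of e] \<open>L \<ge> 0\<close> by (simp add: B_def)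
  qed
  define X where "X = (LEAST m. q \<le> K * (m + 1) ^ D)"
  have "q \<le> K * (q + 1) ^ D"
  proof -
    have "q + 1 \<le> (q + 1) ^ D" using D by (intro self_le_power) auto
    also have "\<dots> \<le> K * (q + 1) ^ D" using K0 by simp
    finally show ?thesis by simp
  qed
  hence X_ge: "q \<le> K * (X + 1) ^ D" unfolding X_def by (rule LeastI)
  have "X \<noteq> 0"
  proof
    assume "X = 0"
    with X_ge q K0 show False by simp
  qed
  then obtain X' where X': "X = Suc X'" using not0_implies_Suc by blast
  have "X' < X" by (simp add: X')
  hence "\<not> q \<le> K * (X' + 1) ^ D" unfolding X_def by (rule not_less_Least)
  hence X_less: "K * X ^ D < q" by (simp add: X')
  have "2 * D * X * B + 1 < (X + 1) ^ D"
  proof -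
    have "X ^ D \<le> q" using X_less K0 by (metis le_less_trans less_imp_le mult_le_mono1 nat_mult_1 Suc_leI One_nat_def)
    hence "real X ^ D \<le> real q" by (metis of_nat_le_iff of_nat_power)
    hence "(real X powr real D) powr (1 / real D) \<le> real q powr (1 / real D)"
      using X' by (intro powr_mono2) (auto simp: powr_realpow)
    hence XD: "real X \<le> real q powr (1 / real D)" using D X' by (simp add: powr_powr)
    have "real X * real B \<le> real q powr (1 / real D) * L"
      using XD \<open>L \<ge> 0\<close> by (intro mult_mono) (auto simp: B_def)
    also have "\<dots> = inverse C * real q" using q0
      by (simp add: L_def powr_add[symmetric])
    finally have XB: "real X * real B \<le> inverse C * real q" .
    have "2 * real D * (real X * real B) \<le> 2 * real D * (inverse C * real q)"
      using XB by (intro mult_left_mono) auto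
    also have "\<dots> \<le> 2 * real D * (inverse (4 * real D * real K) * real q)"
      using C D K0 unfolding D_def[symmetric] by (intro mult_left_mono mult_right_mono le_imp_inverse_le) auto
    also have "\<dots> = real q / (2 * real K)" using D K0 by (simp add: field_simps)
    finally have 1: "2 * real D * (real X * real B) \<le> real q / (2 * real K)" .
    have 2: "1 < real q / (2 * real K)" using q K0 by (simp add: field_simps flip: of_nat_mult)
    have "real q \<le> real (K * (X + 1) ^ D)" using X_ge by (rule of_nat_mono)
    hence 3: "real q / (2 * real K) + real q / (2 * real K) \<le> real ((X + 1) ^ D)"
      using K0 by (simp add: field_simps)
    from 1 2 3 have "real (2 * D * X * B + 1) < real ((X + 1) ^ D)" by (simp add: mult.assoc)
    thus ?thesis by (simp only: of_nat_less_iff)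
  qed
  hence "\<exists>x. (\<exists>e\<in>E. x e \<noteq> 0) \<and> (\<forall>e\<in>E. \<bar>x e\<bar> \<le> int X) \<and> (\<Sum>e\<in>E. x e * v e) = 0"
    unfolding D_def by (intro ex_small_integer_relation finite_E) (simp_all add: vB)
  then obtain x where x: "\<exists>e\<in>E. x e \<noteq> 0" "\<forall>e\<in>E. \<bar>x e\<bar> \<le> int X" "(\<Sum>e\<in>E. x e * v e) = 0"
    by blast
  have "q \<le> (2 * (card E ^ 2 * (n * X * M) + 1)) ^ card E"
  proof (rule modulus_le_norm_bound[OF q0 \<beta>_one \<beta>_mult _ _ M])
    show "\<exists>e\<in>E. int n * x e \<noteq> 0" using x(1) n by auto
    show "\<bar>int n * x e\<bar> \<le> int (n * X)" if "e \<in> E" for e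
      using x(2) that by (simp add: abs_mult mult_left_mono)
    have "[(\<Sum>e\<in>E. x e * (int n * \<beta> e)) = (\<Sum>e\<in>E. x e * v e)] (mod int q)"
      by (intro cong_sum cong_mult cong_refl cong_sym[OF v(1)])
    thus "[(\<Sum>e\<in>E. int n * x e * \<beta> e) = 0] (mod int q)" using x(3) by (simp add: mult_ac)
  qed
  also have "\<dots> \<le> ((2 * (card E ^ 2 * (n * M) + 1)) * X) ^ card E"
    using X' by (intro power_mono) (auto simp: algebra_simps)
  also have "\<dots> = K * X ^ D" by (simp only: K D_def power_mult_distrib)
  finally show False using X_less by simp
qed

section \<open>Large multiples of roots\<close>

lemma ex_units_of_ex_int:
  fixes q n :: nat and C t :: real
  assumes q: "q > 1" and \<beta>: "coprime \<beta> (int q)" and a: "[\<beta> ^ n = a] (mod int q)" "\<bar>of_int a\<bar> < C"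
    and t: "real (residue_abs q (int n * \<beta>)) > t"
  shows "\<exists>\<alpha> \<in> Units (residue_ring (int q)). \<exists>\<beta> \<in> Units (residue_ring (int q)).
    real (residue_abs q \<alpha>) < C \<and> \<beta> [^]\<^bsub>residue_ring (int q)\<^esub> n = \<alpha> \<and>
    real (residue_abs q ([n] \<cdot>\<^bsub>residue_ring (int q)\<^esub> \<beta>)) > t"
proof -
  interpret R: residues "int q" "residue_ring (int q)"
    using q by unfold_locales simp_all
  have unit: "x mod int q \<in> Units (residue_ring (int q))" if "coprime x (int q)" for x
    using q that by (intro R.mod_in_res_units) auto
  have mult: "[m] \<cdot>\<^bsub>residue_ring (int q)\<^esub> (\<beta> mod int q) = (int m * \<beta>) mod int q" for m
    by (induction m) (simp_all add: R.add.nat_pow_Suc R.add_cong R.zero_cong algebra_simps add_pow_def)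
  have "coprime a (int q)"
    using \<beta> cong_imp_coprime[OF a(1)] by simp
  moreover have "(\<beta> mod int q) [^]\<^bsub>residue_ring (int q)\<^esub> n = a mod int q"
    using a(1) by (simp add: R.pow_cong cong_def)
  moreover have "real (residue_abs q (a mod int q)) < C"
    using residue_abs_le[of a "a mod int q" q] a(2) by (simp add: cong_def)
  moreover have "residue_abs q ((int n * \<beta>) mod int q) = residue_abs q (int n * \<beta>)"
    by (rule residue_abs_cong) simp
  ultimately show ?thesis
    using \<beta> t unit mult
    by (intro bexI[of _ "a mod int q"] bexI[of _ "\<beta> mod int q"] conjI) simp_all
qed

lemma ex_torsion_root:
  fixes n k q :: nat
  assumes n: "n > 0" and k: "k > 0" and q: "q > 0" and G: "card (wild_primes n q) \<ge> k"
  shows "\<exists>z. coprime z (int q) \<and> [z ^ n = 1] (mod int q) \<and>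
    real (residue_abs q (int n * z)) \<ge> real q powr (1 - 1 / real k) - real n"
proof -
  have "wild_primes n q \<subseteq> prime_factors q" by (auto simp: wild_primes_def)
  from ex_small_prime_power_factor[OF q this G k] obtain p where pG: "p \<in> wild_primes n q"
    and small: "(p ^ multiplicity p q) ^ k \<le> q" by blast
  have p: "prime p" "p dvd q" "\<not> p dvd n" "\<not> coprime n (p - 1)"
    using pG by (auto simp: wild_primes_def in_prime_factors_iff)
  define v where "v = multiplicity p q"
  define m1 where "m1 = p ^ v"
  have "v > 0" unfolding v_def using p q by (intro multiplicity_pos)
  obtain m2 where m2: "q = m1 * m2" "\<not> p dvd m2"
    unfolding m1_def v_def
    by (rule multiplicity_decompose'[of q p]) (use q p(1) not_prime_unit in auto)
  have "m1 > 0" using p(1) by (simp add: m1_def prime_gt_0_nat)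
  have "coprime p m2" using p(1) m2(2) by (rule prime_imp_coprime)
  hence "coprime m1 m2" by (simp add: m1_def)
  moreover have "coprime p n" using p(1,3) by (rule prime_imp_coprime)
  hence "coprime n m1" by (simp add: m1_def coprime_commute)
  moreover obtain z0 where "[z0 ^ n = 1] (mod m1)" "\<not> [z0 = 1] (mod m1)"
    using ex_nontrivial_root_of_unity_mod_prime_power[OF p(1,4) \<open>v > 0\<close>] unfolding m1_def by blast
  ultimately obtain z where z: "[z ^ n = 1] (mod int q)"
    and w: "\<And>w. [w = int n * z] (mod int q) \<Longrightarrow> \<bar>w\<bar> \<ge> int m2 - int n"
    using ex_root_of_unity_large_multiple unfolding m2(1) by blast
  have "coprime (z ^ n) (int q)" using cong_imp_coprime[OF cong_sym[OF z]] by simp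
  hence "coprime z (int q)" using n by simp
  moreover have "real (residue_abs q (int n * z)) \<ge> real q powr (1 - 1 / real k) - real n"
  proof -
    obtain w0 where w0: "[w0 = int n * z] (mod int q)" "int (residue_abs q (int n * z)) = \<bar>w0\<bar>"
      using residue_abs_witness by blast
    have "real m1 ^ k \<le> real q" using small unfolding m1_def v_def by (metis of_nat_le_iff of_nat_power)
    hence "(real m1 powr real k) powr (1 / real k) \<le> real q powr (1 / real k)"
      using \<open>m1 > 0\<close> by (intro powr_mono2) (auto simp: powr_realpow)
    hence "real m1 \<le> real q powr (1 / real k)" using k \<open>m1 > 0\<close> by (simp add: powr_powr)
    hence "real q powr (1 - 1 / real k) * real m1 \<le> real q powr (1 - 1 / real k) * real q powr (1 / real k)"
      by (intro mult_left_mono) auto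
    also have "\<dots> = real m2 * real m1" using q by (simp add: powr_add[symmetric] m2(1))
    finally have "real q powr (1 - 1 / real k) \<le> real m2" using \<open>m1 > 0\<close> by simp
    moreover have "int m2 - int n \<le> int (residue_abs q (int n * z))" using w[OF w0(1)] w0(2) by simp
    hence "real m2 - real n \<le> real (residue_abs q (int n * z))" by linarith
    ultimately show ?thesis by linarith
  qed
  ultimately show ?thesis using z by blast
qed

lemma ex_increasing_primes:
  fixes n :: nat
  assumes n: "n \<ge> 2"
  obtains L :: "nat \<Rightarrow> nat" where "strict_mono L" and "\<And>i. prime (L i)" and "\<And>i. L i > n"
    and "\<And>i. \<not> coprime n (L i - 1)"
proof -
  obtain r where r: "prime r" "r dvd n" using n prime_factor_nat[of n] by auto
  define S where "S = {p. prime p \<and> r dvd p - 1} - {..n}"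
  have S: "infinite S" unfolding S_def
    using infinite_primes_cong_1_mod_prime[OF r(1)] by (intro Diff_infinite_finite) auto
  have mem: "enumerate S i \<in> S" for i using S by (rule enumerate_in_set)
  show ?thesis
  proof (rule that[of "enumerate S"])
    show "strict_mono (enumerate S)" using S by (rule strict_mono_enumerate)
    show "prime (enumerate S i)" "enumerate S i > n" for i using mem[of i] by (auto simp: S_def)
    show "\<not> coprime n (enumerate S i - 1)" for i
    proof (rule not_coprimeI)
      show "r dvd n" by (rule r(2))
      show "r dvd enumerate S i - 1" using mem[of i] by (auto simp: S_def)
      show "\<not> is_unit r" using r(1) not_prime_unit by blast
    qed
  qed
qed

lemma ex_radical_root:
  fixes n k q W M K :: nat and L :: "nat \<Rightarrow> nat" and C :: real
  assumes n: "n \<ge> 2" and q: "q > 0" and G: "card (wild_primes n q) < k"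
    and L: "strict_mono L" "\<And>i. prime (L i)" "\<And>i. L i > n" "\<And>i. \<not> coprime n (L i - 1)"
    and W: "W = n ^ 3 * n ^ k + k"
    and M: "M = L (k * W) ^ n"
    and K: "K = (2 * ((n ^ k) ^ 2 * (n * M ^ k) + 1)) ^ n ^ k"
    and qK: "q > 2 * K" and C: "C \<ge> 4 * real (n ^ k) * real K"
  shows "\<exists>\<beta> a. coprime \<beta> (int q) \<and> [\<beta> ^ n = int a] (mod int q) \<and> a \<le> (M ^ n) ^ k \<and>
    real (residue_abs q (int n * \<beta>)) > inverse C * real q powr (1 - 1 / real k)"
proof -
  have n0: "n > 0" using n by simp
  have k: "k > 0" using G by simp
  have injL: "L i = L j \<longleftrightarrow> i = j" for i j using L(1) by (simp add: strict_mono_eq)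
  have "\<exists>i j. u * W \<le> i \<and> i < u * W + W \<and> u * W \<le> j \<and> j < u * W + W \<and> i \<noteq> j \<and>
      coprime (L i) q \<and> coprime (L j) q \<and> (\<exists>y. [y ^ n = L i * L j ^ (n - 1)] (mod q))" for u
  proof -
    define Z where "Z = L ` {u * W..<u * W + W}"
    define Z' where "Z' = {l \<in> Z. coprime l q}"
    have "finite Z" by (simp add: Z_def)
    have "card Z = W" unfolding Z_def using injL by (simp add: card_image inj_on_def)
    have sub: "Z - Z' \<subseteq> wild_primes n q"
    proof
      fix l assume "l \<in> Z - Z'"
      then obtain i where i: "l = L i" "\<not> coprime l q" unfolding Z_def Z'_def by auto
      hence "l dvd q" using L(2) prime_imp_coprime by blast
      moreover have "\<not> l dvd n" using L(3)[of i] n i(1) by (auto dest: dvd_imp_le)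
      ultimately show "l \<in> wild_primes n q"
        using i(1) L(2,4) q by (auto simp: wild_primes_def in_prime_factors_iff)
    qed
    have fin: "finite (wild_primes n q)" by (simp add: wild_primes_def)
    have "card (Z - Z') < k" using card_mono[OF fin sub] G by simp
    moreover have "card (Z - Z') = card Z - card Z'"
      using \<open>finite Z\<close> by (intro card_Diff_subset) (auto simp: Z'_def)
    ultimately have "card Z' > n ^ 3 * n ^ k" using \<open>card Z = W\<close> W by linarith
    moreover have "n ^ 3 * n ^ card (wild_primes n q) \<le> n ^ 3 * n ^ k"
      using G n by (intro mult_left_mono power_increasing) auto
    ultimately have "card Z' > n ^ 3 * n ^ card (wild_primes n q)" by (rule le_less_trans[rotated])
    moreover have "finite Z'" "\<And>l. l \<in> Z' \<Longrightarrow> coprime l q" using \<open>finite Z\<close> by (auto simp: Z'_def)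
    ultimately obtain l l' where l: "l \<in> Z'" "l' \<in> Z'" "l \<noteq> l'" "\<exists>y. [y ^ n = l * l' ^ (n - 1)] (mod q)"
      using ex_pair_nth_power[OF q n0] by meson
    then obtain i j where "l = L i" "l' = L j" "i \<in> {u * W..<u * W + W}" "j \<in> {u * W..<u * W + W}"
      unfolding Z'_def Z_def by auto
    with l show ?thesis unfolding Z'_def by auto
  qed
  then obtain I J Y where IJ: "\<And>u. u * W \<le> I u" "\<And>u. I u < u * W + W" "\<And>u. u * W \<le> J u"
      "\<And>u. J u < u * W + W" "\<And>u. I u \<noteq> J u"
    and cop: "\<And>u. coprime (L (I u)) q" "\<And>u. coprime (L (J u)) q"
    and Y: "\<And>u. [Y u ^ n = L (I u) * L (J u) ^ (n - 1)] (mod q)"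
    by metis
  define a where "a = (\<lambda>u. L (I u) * L (J u) ^ (n - 1))"
  have separate: "i < j" if "i < u * W + W" "v * W \<le> j" "u < v" for i j u v
  proof -
    have "Suc u * W \<le> v * W" using that(3) by (intro mult_right_mono) auto
    thus ?thesis using that by simp
  qed
  interpret B: order_basis "exps n k" "exp_add n k" "carry n k (\<lambda>i. int (a i))" "\<lambda>i\<in>{..<k}. 0"
      "radprod k (\<lambda>i. root n (real (a i)))"
  proof (rule order_basis_radicals[OF n0, where p = "\<lambda>u. L (I u)"])
    show "prime (L (I u))" for u by (rule L(2))
    show "\<not> L (I u) dvd n" for u using L(3)[of "I u"] n by (auto dest: dvd_imp_le)
    show "L (I u) dvd a u" for u by (simp add: a_def)
    have ne: "\<not> L i dvd L j ^ m" if "i \<noteq> j" for i j m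
      using that prime_dvd_power[OF L(2)] primes_dvd_imp_eq[OF L(2) L(2)] injL by blast
    show "\<not> (L (I u))\<^sup>2 dvd a u" for u
      using ne[OF IJ(5), of u "n - 1"] prime_gt_0_nat[OF L(2)] by (simp add: a_def power2_eq_square)
    show "\<not> L (I u) dvd a v" if "v < u" for u v
      using ne[of "I u" "I v" 1] ne[of "I u" "J v" "n - 1"] separate[OF IJ(2,1) that]
        separate[OF IJ(4,1) that] prime_dvd_mult_iff[OF L(2)]
      by (auto simp: a_def)
  qed
  have a_bound: "a u \<le> M" if "u < k" for u
  proof -
    have "Suc u * W \<le> k * W" using that by (intro mult_right_mono) auto
    hence "I u \<le> k * W" "J u \<le> k * W" using IJ(2,4)[of u] by simp_all
    hence "L (I u) \<le> L (k * W)" "L (J u) \<le> L (k * W)"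
      using L(1) by (simp_all add: strict_mono_less_eq)
    hence "a u \<le> L (k * W) * L (k * W) ^ (n - 1)"
      unfolding a_def by (intro mult_mono power_mono) auto
    also have "\<dots> = M" using n0 by (simp add: M power_eq_if)
    finally show ?thesis .
  qed
  have M1: "M \<ge> 1" using prime_gt_0_nat[OF L(2)] by (simp add: M Suc_le_eq)
  define \<beta> where "\<beta> = radprod k (\<lambda>u. int (Y u))"
  have Ya: "[int (Y u) ^ n = int (a u)] (mod int q)" for u
    using Y[of u] unfolding a_def of_nat_power[symmetric] cong_int_iff .
  have "\<exists>e\<in>exps n k. real (residue_abs q (int n * \<beta> e)) >
      inverse C * real q powr (1 - 1 / real (card (exps n k)))"
  proof (rule B.ex_large_residue)
    show "\<beta> (\<lambda>i\<in>{..<k}. 0) = 1" by (simp add: \<beta>_def radprod_def)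
    show "[\<beta> e * \<beta> f = carry n k (\<lambda>i. int (a i)) e f * \<beta> (exp_add n k e f)] (mod int q)" for e f
      unfolding \<beta>_def radprod_mult[of k _ e f n] carry_def
      by (intro cong_mult cong_refl cong_prod cong_pow Ya)
    show "\<bar>carry n k (\<lambda>i. int (a i)) e f\<bar> \<le> int (M ^ k)" if e: "e \<in> exps n k" "f \<in> exps n k" for e f
    proof -
      have "a i ^ ((e i + f i) div n) \<le> M" if "i < k" for i
      proof -
        have "e i < n" "f i < n"
          using PiE_mem[OF e(1)[unfolded exps_def], of i] PiE_mem[OF e(2)[unfolded exps_def], of i] that
          by auto
        hence "(e i + f i) div n < 2" using n0 by (simp add: div_less_iff_less_mult)
        hence "a i ^ ((e i + f i) div n) \<le> M ^ ((e i + f i) div n)" "M ^ ((e i + f i) div n) \<le> M ^ 1"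
          using a_bound[OF that] M1 by (intro power_mono power_increasing; simp)+
        thus ?thesis by simp
      qed
      hence "(\<Prod>i<k. a i ^ ((e i + f i) div n)) \<le> (\<Prod>i<k. M)" by (intro prod_mono) auto
      thus ?thesis unfolding carry_def by (simp flip: of_nat_power of_nat_prod)
    qed
    show "n > 0" by (rule n0)
    show "K = (2 * ((card (exps n k))\<^sup>2 * (n * M ^ k) + 1)) ^ card (exps n k)"
      unfolding K card_exps ..
    show "2 * K < q" by (rule qK)
    show "4 * real (card (exps n k)) * real K \<le> C" using C by (simp add: card_exps)
  qed
  then obtain e where e: "e \<in> exps n k"
    and large: "real (residue_abs q (int n * \<beta> e)) > inverse C * real q powr (1 - 1 / real (n ^ k))"
    unfolding card_exps by blast
  have "C > 0" using C n0 K by (smt (verit) mult_nonneg_nonneg of_nat_0_le_iff of_nat_0_less_iff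
    zero_less_power mult_pos_pos add_gr_0 zero_less_one zero_less_numeral)
  have "k \<le> n ^ k" using n by (metis less_imp_le power_gt_expt Suc_le_eq One_nat_def numeral_2_eq_2)
  hence "1 - 1 / real k \<le> 1 - 1 / real (n ^ k)"
    using k by (intro diff_left_mono divide_left_mono) (auto simp del: of_nat_power simp: n0)
  hence "real q powr (1 - 1 / real k) \<le> real q powr (1 - 1 / real (n ^ k))"
    using q by (intro powr_mono) auto
  hence "inverse C * real q powr (1 - 1 / real k) < real (residue_abs q (int n * \<beta> e))"
    using large \<open>C > 0\<close> by (meson less_eq_real_def inverse_nonnegative_iff_nonnegative mult_left_mono le_less_trans)
  moreover have "[\<beta> e ^ n = int (radprod k a e)] (mod int q)"
    unfolding \<beta>_def radprod_power of_nat_radprod[symmetric] unfolding radprod_def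
    by (intro cong_prod cong_pow Ya)
  moreover have "coprime (\<beta> e) (int q)"
  proof -
    have "coprime (a u) q" for u unfolding a_def using cop by (simp add: coprime_power_left_iff)
    hence "coprime (radprod k a e) q"
      unfolding radprod_def by (intro prod_coprime_left) (simp add: coprime_power_left_iff)
    hence "coprime (int (radprod k a e)) (int q)" by (simp only: coprime_int_iff)
    hence "coprime (\<beta> e ^ n) (int q)"
      using cong_imp_coprime[OF cong_sym] calculation(2) by blast
    thus ?thesis using n0 by simp
  qed
  moreover have "radprod k a e \<le> (M ^ n) ^ k"
  proof -
    have "a i ^ e i \<le> M ^ n" if "i < k" for i
    proof -
      have "e i < n" using PiE_mem[OF e[unfolded exps_def], of i] that by simp
      hence "a i ^ e i \<le> M ^ e i" "M ^ e i \<le> M ^ n"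
        using a_bound[OF that] M1 by (intro power_mono power_increasing; simp)+
      thus ?thesis by simp
    qed
    hence "radprod k a e \<le> (\<Prod>i<k. M ^ n)" unfolding radprod_def by (intro prod_mono) auto
    thus ?thesis by simp
  qed
  ultimately show ?thesis by blast
qed

lemma residue_abs_pos: "\<not> int q dvd a \<Longrightarrow> residue_abs q a \<ge> 1"
  using residue_abs_witness[of a q] by (metis One_nat_def Suc_leI abs_zero cong_0_iff cong_sym gr0I of_nat_0
    abs_eq_0)

theorem theorem1p5:
  fixes k n :: nat
  assumes "k > 0" and "n > 0" and "n = 1 \<longrightarrow> k = 1"
  shows "\<exists>C::real. C > 0 \<and>
    (\<forall>q::nat. q > 0 \<and> \<not> q dvd n \<longrightarrow>
      (\<exists>\<alpha> \<in> Units (residue_ring (int q)). \<exists>\<beta> \<in> Units (residue_ring (int q)).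
        real (residue_abs q \<alpha>) < C \<and>
        \<beta> [^]\<^bsub>residue_ring (int q)\<^esub> n = \<alpha> \<and>
        real (residue_abs q ([n] \<cdot>\<^bsub>residue_ring (int q)\<^esub> \<beta>)) > inverse C * real q powr (1 - 1 / real k)))"
proof -
  have trivial: "\<exists>\<beta> a :: int. coprime \<beta> (int q) \<and> [\<beta> ^ n = a] (mod int q) \<and> \<bar>of_int a\<bar> < C \<and>
      real (residue_abs q (int n * \<beta>)) > inverse C * real q powr (1 - 1 / real k)"
    if "C > 1" "\<not> q dvd n" "real q powr (1 - 1 / real k) < C" for q C
  proof -
    have "inverse C * real q powr (1 - 1 / real k) < inverse C * C"
      using that by (intro mult_strict_left_mono) auto
    also have "\<dots> \<le> real (residue_abs q (int n * 1))"
      using that residue_abs_pos[of q "int n"] by simp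
    finally show ?thesis using that(1) by (intro exI[of _ 1]) auto
  qed
  have "\<exists>C::real. C > 1 \<and> (\<forall>q. q > 0 \<longrightarrow> \<not> q dvd n \<longrightarrow>
      (\<exists>\<beta> a :: int. coprime \<beta> (int q) \<and> [\<beta> ^ n = a] (mod int q) \<and> \<bar>of_int a\<bar> < C \<and>
        real (residue_abs q (int n * \<beta>)) > inverse C * real q powr (1 - 1 / real k)))"
  proof (cases "k = 1")
    case True
    show ?thesis
      by (intro exI[of _ 2] conjI allI impI trivial) (simp_all add: True)
  next
    case False
    with assms have n: "n \<ge> 2" by (cases "n = 1") auto
    obtain L :: "nat \<Rightarrow> nat" where L: "strict_mono L" "\<And>i. prime (L i)" "\<And>i. L i > n" "\<And>i. \<not> coprime n (L i - 1)"
      using ex_increasing_primes[OF n] by blast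
    define W where "W = n ^ 3 * n ^ k + k"
    define M where "M = L (k * W) ^ n"
    define K where "K = (2 * ((n ^ k) ^ 2 * (n * M ^ k) + 1)) ^ n ^ k"
    define C where "C = real (4 * n ^ k * K + 2 * K + 4 * n + (M ^ n) ^ k + 3)"
    have "K \<ge> 1" unfolding K_def by simp
    have C: "C > 1" "C \<ge> 4 * real (n ^ k) * real K" "C > 2 * real K" "C \<ge> 4 * real n" "C > 2"
        "C > real ((M ^ n) ^ k)"
      unfolding C_def using n by (simp_all del: of_nat_power add: add_pos_nonneg add_nonneg_pos)
    have "\<exists>\<beta> a :: int. coprime \<beta> (int q) \<and> [\<beta> ^ n = a] (mod int q) \<and> \<bar>of_int a\<bar> < C \<and>
        real (residue_abs q (int n * \<beta>)) > inverse C * real q powr (1 - 1 / real k)"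
      if q: "q > 0" "\<not> q dvd n" for q
    proof (cases "real q powr (1 - 1 / real k) < C")
      case True
      thus ?thesis using trivial C(1) q(2) by blast
    next
      case False
      define t where "t = real q powr (1 - 1 / real k)"
      have t: "t \<ge> C" using False by (simp add: t_def)
      show ?thesis
      proof (cases "card (wild_primes n q) \<ge> k")
        case True
        obtain z where z: "coprime z (int q)" "[z ^ n = 1] (mod int q)"
            "real (residue_abs q (int n * z)) \<ge> t - real n"
          using ex_torsion_root[OF assms(2,1) q(1) True] unfolding t_def by blast
        have "inverse C < inverse 2" using C(5) by (intro less_imp_inverse_less) auto
        hence "inverse C * t < inverse 2 * t" using t C(5) by (intro mult_strict_right_mono) auto
        also have "\<dots> \<le> t - real n" using t C by simp
        also note z(3)
        finally show ?thesis using z(1,2) C(1) unfolding t_def by (intro exI[of _ z] exI[of _ 1]) simp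
      next
        case False
        have "t \<le> real q powr 1" unfolding t_def using q by (intro powr_mono) auto
        hence "real (2 * K) < real q" using t C(3) q by simp
        hence "2 * K < q" by (simp only: of_nat_less_iff)
        then obtain \<beta> a where "coprime \<beta> (int q)" "[\<beta> ^ n = int a] (mod int q)" "a \<le> (M ^ n) ^ k"
            "real (residue_abs q (int n * \<beta>)) > inverse C * t"
          using ex_radical_root[OF n q(1) _ L W_def M_def K_def _ C(2)] False unfolding t_def by force
        moreover from this(3) have "\<bar>of_int (int a)\<bar> < C"
          using C(6) by (smt (verit) of_int_of_nat_eq of_nat_0_le_iff of_nat_mono)
        ultimately show ?thesis unfolding t_def by blast
      qed
    qed
    thus ?thesis using C(1) by blast
  qed
  then obtain C where C: "C > 1" and main: "\<And>q. q > 0 \<Longrightarrow> \<not> q dvd n \<Longrightarrow>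
      \<exists>\<beta> a :: int. coprime \<beta> (int q) \<and> [\<beta> ^ n = a] (mod int q) \<and> \<bar>of_int a\<bar> < C \<and>
        real (residue_abs q (int n * \<beta>)) > inverse C * real q powr (1 - 1 / real k)"
    by blast
  show ?thesis
  proof (intro exI[of _ C] conjI allI impI)
    show "C > 0" using C by simp
    fix q :: nat assume q: "q > 0 \<and> \<not> q dvd n"
    hence "q \<noteq> 1" by auto
    with q have "q > 1" by linarith
    with main[of q] q show "\<exists>\<alpha> \<in> Units (residue_ring (int q)). \<exists>\<beta> \<in> Units (residue_ring (int q)).
        real (residue_abs q \<alpha>) < C \<and>
        \<beta> [^]\<^bsub>residue_ring (int q)\<^esub> n = \<alpha> \<and>
        real (residue_abs q ([n] \<cdot>\<^bsub>residue_ring (int q)\<^esub> \<beta>)) > inverse C * real q powr (1 - 1 / real k)"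
      using ex_units_of_ex_int by blast
  qed
qed

end
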